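(* Let $n=1$, let $H:\mathbb{R}\to\mathbb{R}$ be continuous and coercive (i.e. $H(p)\to+\infty$ as $|p|\to\infty$), and let $V_1,V_2\in C(\mathbb{T})$. For $i=1,2$ let $\overline H_i$ be the effective Hamiltonian associated with $H(p)+V_i(x)$. Then the following hold. (1) If $H$ is quasi-convex, then $$V_1\text{ and }V_2\text{ have the same distribution}\ \Longrightarrow\ \overline H_1\equiv\overline H_2.$$ (2) If $H$ is strongly superlinear, then $$\overline H_1\equiv\overline H_2\ \Longrightarrow\ V_1\text{ and }V_2\text{ have the same distribution}.$$
   Context: $\mathbb{T}=\mathbb{R}/\mathbb{Z}$; functions on $\mathbb{T}$ are identified with $1$-periodic functions on $\mathbb{R}$. For a continuous coercive $H:\mathbb{R}\to\mathbb{R}$ and $V\in C(\mathbb{T})$, the effective Hamiltonian $\overline H:\mathbb{R}\to\mathbb{R}$ associated with $H(p)+V(x)$ is defined as follows: for each $p\in\mathbb{R}$, $\overline H(p)$ is the unique constant $c\in\mathbb{R}$ such that the cell problem $H(p+v'(x))+V(x)=c$ in $\mathbb{T}$ has a continuous viscosity solution $v\in C(\mathbb{T})$. $V_1$ and $V_2$ have the same distribution if $\int_0^1f(V_1(x))\,dx=\int_0^1f(V_2(x))\,dx$ for every $f\in C(\mathbb{R})$. $H$ is quasi-convex if $\{p: H(p)\le c\}$ is convex for every $c\in\mathbb{R}$. $H$ is called strongly superlinear if there exists $a\in\mathbb{R}$ such that the restriction $H|_{[a,+\infty)}$ is smooth, strictly increasing, and $$\lim_{x\to+\infty}\frac{\psi^{(k)}(x)}{\psi^{(k-1)}(x)}=0\quad\text{for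 all }k\in\mathbb{N}=\{1,2,\dots\},$$ where $\psi=\psi^{(0)}=\left(H|_{[a,+\infty)}\right)^{-1}:[H(a),+\infty)\to[a,+\infty)$ and $\psi^{(k)}$ is the $k$-th derivative of $\psi$ (it is understood that, for each $k$, these derivatives and quotients are defined for all large $x$). *)

theory Defs
  imports "HOL-Analysis.Analysis"
begin

text \<open>Functions on the torus \<open>\<real>/\<int>\<close> are represented by 1-periodic functions on \<open>\<real>\<close>.\<close>

definition C_torus :: "(real \<Rightarrow> real) set" where
  "C_torus = {v. continuous_on UNIV v \<and> (\<forall>x. v (x + 1) = v x)}"

definition C1_with_deriv :: "(real \<Rightarrow> real) \<Rightarrow> (real \<Rightarrow> real) \<Rightarrow> bool" where
  "C1_with_deriv \<phi> \<phi>' \<longleftrightarrow>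
     (\<forall>x. (\<phi> has_real_derivative \<phi>' x) (at x)) \<and> continuous_on UNIV \<phi>'"

text \<open>Viscosity sub- and supersolutions of \<open>G (v' x) x = 0\<close> on \<open>\<real>\<close>. The test functions touch
  only locally, so they need not be periodic.\<close>

definition viscosity_subsolution ::
    "(real \<Rightarrow> real \<Rightarrow> real) \<Rightarrow> (real \<Rightarrow> real) \<Rightarrow> bool" where
  "viscosity_subsolution G v \<longleftrightarrow>
     (\<forall>\<phi> \<phi>' x. C1_with_deriv \<phi> \<phi>' \<and> (\<forall>\<^sub>F y in nhds x. v y - \<phi> y \<le> v x - \<phi> x)
        \<longrightarrow> G (\<phi>' x) x \<le> 0)"

definition viscosity_supersolution ::
    "(real \<Rightarrow> real \<Rightarrow> real) \<Rightarrow> (real \<Rightarrow> real) \<Rightarrow> bool" where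
  "viscosity_supersolution G v \<longleftrightarrow>
     (\<forall>\<phi> \<phi>' x. C1_with_deriv \<phi> \<phi>' \<and> (\<forall>\<^sub>F y in nhds x. v y - \<phi> y \<ge> v x - \<phi> x)
        \<longrightarrow> G (\<phi>' x) x \<ge> 0)"

definition viscosity_solution ::
    "(real \<Rightarrow> real \<Rightarrow> real) \<Rightarrow> (real \<Rightarrow> real) \<Rightarrow> bool" where
  "viscosity_solution G v \<longleftrightarrow> viscosity_subsolution G v \<and> viscosity_supersolution G v"

definition cell_solution ::
    "(real \<Rightarrow> real) \<Rightarrow> (real \<Rightarrow> real) \<Rightarrow> real \<Rightarrow> real \<Rightarrow> (real \<Rightarrow> real) \<Rightarrow> bool" where
  "cell_solution H V p c v \<longleftrightarrow>
     v \<in> C_torus \<and> viscosity_solution (\<lambda>q x. H (p + q) + V x - c) v"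

definition effective_hamiltonian :: "(real \<Rightarrow> real) \<Rightarrow> (real \<Rightarrow> real) \<Rightarrow> real \<Rightarrow> real" where
  "effective_hamiltonian H V p = (THE c. \<exists>v. cell_solution H V p c v)"

definition same_distribution :: "(real \<Rightarrow> real) \<Rightarrow> (real \<Rightarrow> real) \<Rightarrow> bool" where
  "same_distribution V1 V2 \<longleftrightarrow>
     (\<forall>f::real \<Rightarrow> real. continuous_on UNIV f \<longrightarrow>
        integral {0..1} (\<lambda>x. f (V1 x)) = integral {0..1} (\<lambda>x. f (V2 x)))"

definition coercive :: "(real \<Rightarrow> real) \<Rightarrow> bool" where
  "coercive H \<longleftrightarrow> filterlim H at_top at_infinity"

definition quasi_convex :: "(real \<Rightarrow> real) \<Rightarrow> bool" where
  "quasi_convex H \<longleftrightarrow> (\<forall>c. convex {p. H p \<le> c})"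

text \<open>\<open>D k\<close> is the \<open>k\<close>-th derivative of the restriction of \<open>f\<close> to \<open>[a, \<infinity>)\<close>,
  one-sided at \<open>a\<close>.\<close>

definition smooth_on_ray :: "(real \<Rightarrow> real) \<Rightarrow> real \<Rightarrow> bool" where
  "smooth_on_ray f a \<longleftrightarrow>
     (\<exists>D :: nat \<Rightarrow> real \<Rightarrow> real. (\<forall>x\<ge>a. D 0 x = f x) \<and>
        (\<forall>k. \<forall>x\<ge>a. (D k has_real_derivative D (Suc k) x) (at x within {a..})))"

text \<open>For continuous coercive \<open>H\<close> that is strictly increasing on \<open>[a, \<infinity>)\<close>, the function \<open>\<psi>\<close> below
  is the inverse of the restriction of \<open>H\<close> on \<open>[H a, \<infinity>)\<close> and unspecified outside. Since \<open>deriv\<close>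
  and division are total, the existence of the derivatives and quotients for all large arguments
  (with a bound that may depend on \<open>k\<close>) is required explicitly.\<close>

definition strongly_superlinear :: "(real \<Rightarrow> real) \<Rightarrow> bool" where
  "strongly_superlinear H \<longleftrightarrow>
     (\<exists>a. smooth_on_ray H a \<and> strict_mono_on {a..} H \<and>
        (let \<psi> = the_inv_into {a..} H in
         \<forall>k. (\<forall>\<^sub>F x in at_top. (deriv ^^ k) \<psi> field_differentiable at x) \<and>
             (\<forall>\<^sub>F x in at_top. (deriv ^^ k) \<psi> x \<noteq> 0) \<and>
             ((\<lambda>x. (deriv ^^ Suc k) \<psi> x / (deriv ^^ k) \<psi> x) \<longlongrightarrow> 0) at_top))"

end

theory Submission
  imports Defs
begin

text \<open>
  If \<open>v\<close> solves the cell problem at \<open>p\<close> with constant \<open>c\<close>, then comparing \<open>v\<close> at an extremum with a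
  periodic \<open>w\<close> of class \<open>C\<^sup>1\<close> shows \<open>c \<le> c'\<close> as soon as \<open>H (p + w') + V \<le> c'\<close>, and dually.

  Part (1). For quasi-convex \<open>H\<close> let \<open>[\<psi>\<^sub>-(s), \<psi>\<^sub>+(s)] = {H \<le> s}\<close>. A subsolution at level \<open>c\<close> forces
  \<open>min H + max V \<le> c\<close> and \<open>\<integral>\<psi>\<^sub>-(c - V) \<le> p \<le> \<integral>\<psi>\<^sub>+(c - V)\<close>, which depends on the distribution of \<open>V\<close>
  only. Conversely, averaging \<open>\<psi>\<^sub>\<plusminus>\<close> over \<open>[s, s + \<epsilon>]\<close> turns these inequalities into a \<open>C\<^sup>1\<close> subsolution at
  level \<open>c + \<epsilon>\<close>. Hence the constants of any two solutions for equally distributed potentials agree. Existence is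
  explicit: \<open>p + v'\<close> switches from \<open>\<psi>\<^sub>+(c - V)\<close> to \<open>\<psi>\<^sub>-(c - V)\<close> once per period if
  \<open>c = min H + max V\<close>, and above that level it is a convex combination of the one-sided limits of \<open>\<psi>\<^sub>+\<close>
  (or of \<open>\<psi>\<^sub>-\<close>) at \<open>c - V\<close>.

  Part (2). For large \<open>c\<close> the function \<open>p + v' = \<psi>(c - V)\<close> is a classical solution, so that equality of the
  effective Hamiltonians means \<open>\<integral>\<psi>(c - V\<^sub>1) = \<integral>\<psi>(c - V\<^sub>2)\<close>. In the Taylor expansion at \<open>c\<close> each
  term dominates all later ones because \<open>\<psi>\<^sup>(\<^sup>k\<^sup>+\<^sup>1\<^sup>) / \<psi>\<^sup>(\<^sup>k\<^sup>) \<rightarrow> 0\<close>; thus all moments of \<open>V\<^sub>1\<close> and \<open>V\<^sub>2\<close>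
  agree, and the Weierstrass theorem concludes.
\<close>

section \<open>Antiderivatives and one-sided slopes\<close>

text \<open>The case split yields the oriented integral from 0 to \<open>x\<close>, because
  \<open>integral {0..x} g\<close> is 0 for negative \<open>x\<close>.\<close>

definition antideriv :: "(real \<Rightarrow> real) \<Rightarrow> real \<Rightarrow> real" where
  "antideriv g x = (if 0 \<le> x then integral {0..x} g else - integral {x..0} g)"

lemma antideriv_diff:
  assumes "\<And>a b. g integrable_on {a..b}" and "a \<le> b"
  shows "antideriv g b - antideriv g a = integral {a..b} g"
proof -
  have c: "integral {x..y} g + integral {y..z} g = integral {x..z} g" if "x \<le> y" "y \<le> z" for x y z
    using that assms(1) by (intro Henstock_Kurzweil_Integration.integral_combine) auto
  show ?thesis
    using c[of 0 a b] c[of a 0 b] c[of a b 0] assms(2) by (auto simp: antideriv_def)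
qed

lemma antideriv_0 [simp]: "antideriv g 0 = 0"
  by (simp add: antideriv_def)

lemma integral_shift_1:
  fixes g :: "real \<Rightarrow> real"
  assumes "\<And>x. g (x + 1) = g x"
  shows "integral {a+1..b+1} g = integral {a..b} g"
  using integral_shift_real_ivl[of "a+1" 1 "b+1" g] assms by simp

lemma antideriv_periodic:
  assumes "\<And>a b. g integrable_on {a..b}" and per: "\<And>x. g (x + 1) = g x"
  shows "antideriv g (x + 1) = antideriv g x + integral {0..1} g"
proof (cases "0 \<le> x")
  case True
  then show ?thesis
    using antideriv_diff[OF assms(1), of 0 x] antideriv_diff[OF assms(1), of 1 "x+1"]
      antideriv_diff[OF assms(1), of 0 1] integral_shift_1[of g 0 x, OF per] by simp
next
  case False
  then show ?thesis
    using antideriv_diff[OF assms(1), of x 0] antideriv_diff[OF assms(1), of "x+1" 1]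
      antideriv_diff[OF assms(1), of 0 1] integral_shift_1[of g x 0, OF per] by simp
qed

lemma integral_period:
  fixes g :: "real \<Rightarrow> real"
  assumes "\<And>a b. g integrable_on {a..b}" and per: "\<And>x. g (x + 1) = g x"
  shows "integral {a..a+1} g = integral {0..1::real} g"
  using antideriv_diff[OF assms(1), of a "a+1"] antideriv_periodic[OF assms, of a] by simp

lemma continuous_antideriv:
  assumes "\<And>a b. g integrable_on {a..b}"
  shows "continuous_on UNIV (antideriv g)"
proof -
  have "isCont (antideriv g) x" for x
  proof -
    have "continuous_on {x-1..x+1} (\<lambda>y. antideriv g (x-1) + integral {x-1..y} g)"
      by (intro continuous_intros indefinite_integral_continuous_1 assms)
    then have "continuous_on {x-1..x+1} (antideriv g)"
      by (rule continuous_on_eq) (simp add: antideriv_diff[OF assms, symmetric])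
    then show ?thesis
      by (rule continuous_on_interior) auto
  qed
  then show ?thesis by (simp add: continuous_at_imp_continuous_on)
qed

lemma continuous_integrable:
  fixes g :: "real \<Rightarrow> real"
  assumes "continuous_on UNIV g" shows "g integrable_on {a..b}"
  by (meson assms continuous_on_subset integrable_continuous_interval subset_UNIV)

lemma antideriv_has_derivative:
  assumes "continuous_on UNIV g"
  shows "(antideriv g has_real_derivative g x) (at x)"
proof -
  have i: "g integrable_on {a..b}" for a b using assms by (rule continuous_integrable)
  have "((\<lambda>y. integral {x-1..y} g) has_real_derivative g x) (at x within {x-1..x+1})"
    by (rule integral_has_real_derivative) (use assms continuous_on_subset in auto)
  then have "((\<lambda>y. antideriv g (x-1) + integral {x-1..y} g) has_real_derivative 0 + g x) (at x within {x-1..x+1})"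
    by (intro DERIV_add DERIV_const)
  then have "(antideriv g has_real_derivative 0 + g x) (at x within {x-1..x+1})"
    by (rule has_field_derivative_transform_within[OF _ zero_less_one])
       (auto simp: antideriv_diff[OF i, symmetric])
  then show ?thesis
    by (simp add: at_within_Icc_at)
qed

text \<open>The difference quotient tends to \<open>d\<close> along every set \<open>S\<close> that
  accumulates at \<open>x\<close>. Hence a bound on one side of \<open>x\<close> controls the full
  derivative of a test function.\<close>

lemma derivative_le_if_slope_le:
  assumes "(\<phi> has_real_derivative d) (at x)" and "at x within S \<noteq> bot"
    and "\<forall>\<^sub>F y in at x within S. (\<phi> y - \<phi> x) / (y - x) \<le> B"
  shows "d \<le> (B::real)"
proof (rule tendsto_upperbound)
  show "((\<lambda>y. (\<phi> y - \<phi> x) / (y - x)) \<longlongrightarrow> d) (at x within S)"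
    using assms(1) has_field_derivative_at_within has_field_derivative_iff by blast
qed (use assms in auto)

lemma derivative_ge_if_slope_ge:
  assumes "(\<phi> has_real_derivative d) (at x)" and "at x within S \<noteq> bot"
    and "\<forall>\<^sub>F y in at x within S. (\<phi> y - \<phi> x) / (y - x) \<ge> B"
  shows "d \<ge> (B::real)"
proof (rule tendsto_lowerbound)
  show "((\<lambda>y. (\<phi> y - \<phi> x) / (y - x)) \<longlongrightarrow> d) (at x within S)"
    using assms(1) has_field_derivative_at_within has_field_derivative_iff by blast
qed (use assms in auto)

text \<open>End points carry no mass. Only the open interval is inspected since one end point will
  be a touching point, where the slope may jump.\<close>

lemma integral_le_open:
  fixes g :: "real \<Rightarrow> real"
  assumes "g integrable_on {a..b}" "a \<le> b" "\<And>x. a < x \<Longrightarrow> x < b \<Longrightarrow> g x \<le> B"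
  shows "integral {a..b} g \<le> B * (b - a)"
proof -
  have "integral {a..b} g = integral {a<..<b} g" by (rule integral_open_interval_real)
  also have "\<dots> \<le> integral {a<..<b} (\<lambda>_. B)"
    by (rule integral_le) (use assms integrable_on_open_interval_real in \<open>auto simp: integrable_on_open_interval_real\<close>)
  also have "\<dots> = B * (b - a)" using assms(2) integral_open_interval_real[of a b "\<lambda>_. B"]
    by (metis content_real integral_const_real mult.commute real_scaleR_def)
  finally show ?thesis .
qed

lemma integral_ge_open:
  fixes g :: "real \<Rightarrow> real"
  assumes "g integrable_on {a..b}" "a \<le> b" "\<And>x. a < x \<Longrightarrow> x < b \<Longrightarrow> B \<le> g x"
  shows "B * (b - a) \<le> integral {a..b} g"
  using integral_le_open[of "\<lambda>x. - g x" a b "-B"] assms integrable_neg by fastforce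

lemma integral_periodic_reflect:
  fixes g :: "real \<Rightarrow> real"
  assumes "\<And>x. g (x + 1) = g x"
  shows "integral {0..1} (\<lambda>x. g (- x)) = integral {0..1} g"
  using Henstock_Kurzweil_Integration.integral_reflect_real[of 1 0 "\<lambda>x. g (-x)"] integral_shift_1[of g "-1" 0, OF assms] by simp

section \<open>Viscosity solutions of the cell problem\<close>

text \<open>Meant for slopes that are merely Borel: the roots of \<open>H\<close> may jump, and a
  slope may switch from one branch to the other.\<close>

lemma bounded_borel_integrable:
  fixes g :: "real \<Rightarrow> real"
  assumes "g \<in> borel_measurable borel" and "\<And>x. \<bar>g x\<bar> \<le> K"
  shows "g integrable_on {a..b}"
proof (rule set_borel_integral_eq_integral(1))
  show "set_integrable lborel {a..b} g"
  proof (rule set_integrable_bound)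
    show "set_integrable lborel {a..b} (\<lambda>_. K)"
      by (rule borel_integrable_atLeastAtMost') auto
    show "set_borel_measurable lborel {a..b} g"
      unfolding set_borel_measurable_def using assms(1) by measurable
    show "AE x in lborel. x \<in> {a..b} \<longrightarrow> norm (g x) \<le> norm K"
      using assms(2) by (intro AE_I2) (metis abs_ge_self order_trans real_norm_def)
  qed
qed

section \<open>Functions on the torus\<close>

lemma C_torus_continuous: "V \<in> C_torus \<Longrightarrow> continuous_on UNIV V"
  and C_torus_periodic: "V \<in> C_torus \<Longrightarrow> V (x + 1) = V x"
  by (auto simp: C_torus_def)

lemma C_torus_isCont: "V \<in> C_torus \<Longrightarrow> isCont V x"
  using C_torus_continuous continuous_on_eq_continuous_at open_UNIV by blast

lemma periodic_int:
  fixes f :: "real \<Rightarrow> 'a"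
  assumes "\<And>x. f (x + 1) = f x"
  shows "f (x + of_int n) = f x"
proof (induction n rule: int_induct[where k = 0])
  case (step1 i)
  then show ?case using assms[of "x + of_int i"] by (simp add: add.assoc)
next
  case (step2 i)
  then show ?case using assms[of "x + of_int i - 1"] by (simp add: algebra_simps)
qed simp

lemma periodic_frac:
  fixes f :: "real \<Rightarrow> 'a"
  assumes "\<And>x. f (x + 1) = f x"
  shows "f (frac x) = f x"
  using periodic_int[of f "frac x" "\<lfloor>x\<rfloor>", OF assms] by (simp add: frac_def)

lemma C_torus_attains_max:
  assumes "V \<in> C_torus"
  obtains x0 where "\<And>x. V x \<le> V x0"
proof -
  have "continuous_on {0..1} V"
    using C_torus_continuous[OF assms] continuous_on_subset by blast
  then obtain x0 where x0: "\<And>x. x \<in> {0..1} \<Longrightarrow> V x \<le> V x0"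
    using continuous_attains_sup[of "{0..1}" V] by force
  have "V x \<le> V x0" for x
    using x0[of "frac x"] periodic_frac[of V x, OF C_torus_periodic[OF assms]]
    by (simp add: frac_lt_1 less_imp_le)
  then show ?thesis by (rule that)
qed

lemma C_torus_uminus: "V \<in> C_torus \<Longrightarrow> (\<lambda>x. - V x) \<in> C_torus"
  by (auto simp: C_torus_def intro: continuous_intros)

lemma C_torus_diff: "V \<in> C_torus \<Longrightarrow> W \<in> C_torus \<Longrightarrow> (\<lambda>x. V x - W x) \<in> C_torus"
  by (auto simp: C_torus_def intro: continuous_intros)

lemma C_torus_reflect:
  assumes "V \<in> C_torus"
  shows "(\<lambda>x. V (- x)) \<in> C_torus"
proof -
  have "V (- (x + 1)) = V (- x)" for x
    using C_torus_periodic[OF assms, of "- (x + 1)"] by simp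
  then show ?thesis
    unfolding C_torus_def
    using continuous_on_compose2[OF C_torus_continuous[OF assms] continuous_on_minus[OF continuous_on_id]]
    by simp
qed

lemma C_torus_bounded:
  assumes "V \<in> C_torus"
  obtains K where "0 < K" "\<And>x. \<bar>V x\<bar> \<le> K"
proof -
  obtain x0 where x0: "\<And>x. V x \<le> V x0" using C_torus_attains_max[OF assms] by blast
  obtain x1 where x1: "\<And>x. - V x \<le> - V x1" using C_torus_attains_max[OF C_torus_uminus[OF assms]] by blast
  show ?thesis
  proof (rule that[of "\<bar>V x0\<bar> + \<bar>V x1\<bar> + 1"])
    show "\<bar>V x\<bar> \<le> \<bar>V x0\<bar> + \<bar>V x1\<bar> + 1" for x using x0[of x] x1[of x] by linarith
  qed auto
qed

section \<open>Test functions, correctors and comparison\<close>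

lemma C1_with_derivI:
  assumes "\<And>x. (\<phi> has_real_derivative \<phi>' x) (at x)" "continuous_on UNIV \<phi>'"
  shows "C1_with_deriv \<phi> \<phi>'"
  using assms by (auto simp: C1_with_deriv_def)

lemma viscosity_subsolutionD:
  assumes "viscosity_subsolution G v" "C1_with_deriv \<phi> \<phi>'" "\<forall>\<^sub>F y in nhds x. v y - \<phi> y \<le> v x - \<phi> x"
  shows "G (\<phi>' x) x \<le> 0"
  using assms unfolding viscosity_subsolution_def by blast

lemma viscosity_supersolutionD:
  assumes "viscosity_supersolution G v" "C1_with_deriv \<phi> \<phi>'" "\<forall>\<^sub>F y in nhds x. v y - \<phi> y \<ge> v x - \<phi> x"
  shows "G (\<phi>' x) x \<ge> 0"
  using assms unfolding viscosity_supersolution_def by blast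

lemma cell_solutionI:
  assumes "v \<in> C_torus"
    and "\<And>\<phi> \<phi>' y. C1_with_deriv \<phi> \<phi>' \<Longrightarrow> \<forall>\<^sub>F x in nhds y. v x - \<phi> x \<le> v y - \<phi> y \<Longrightarrow> H (p + \<phi>' y) + V y - c \<le> 0"
    and "\<And>\<phi> \<phi>' y. C1_with_deriv \<phi> \<phi>' \<Longrightarrow> \<forall>\<^sub>F x in nhds y. v x - \<phi> x \<ge> v y - \<phi> y \<Longrightarrow> H (p + \<phi>' y) + V y - c \<ge> 0"
  shows "cell_solution H V p c v"
  using assms
  unfolding cell_solution_def viscosity_solution_def viscosity_subsolution_def viscosity_supersolution_def
  by blast

lemma cell_solutionD:
  assumes "cell_solution H V p c v"
  shows "v \<in> C_torus" "viscosity_subsolution (\<lambda>q x. H (p + q) + V x - c) v"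
    "viscosity_supersolution (\<lambda>q x. H (p + q) + V x - c) v"
  using assms by (auto simp: cell_solution_def viscosity_solution_def)

lemma corrector_torus:
  assumes "\<And>a b. g integrable_on {a..b}" and "\<And>x. g (x + 1) = g x" and "integral {0..1} g = p"
  shows "(\<lambda>x. antideriv g x - p * x) \<in> C_torus"
  unfolding C_torus_def
  using antideriv_periodic[OF assms(1,2)] assms(3) continuous_antideriv[OF assms(1)]
  by (auto simp: algebra_simps intro!: continuous_intros)

lemma corrector_C1:
  assumes "continuous_on UNIV g"
  shows "C1_with_deriv (\<lambda>x. antideriv g x - p * x) (\<lambda>x. g x - p)"
  by (rule C1_with_derivI)
     (auto intro!: derivative_eq_intros antideriv_has_derivative continuous_intros assms)

lemma cell_constant_le_if_C1_subsolution:
  assumes "cell_solution H V p c v" and g: "continuous_on UNIV g" "\<And>x. g (x + 1) = g x"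
    and "integral {0..1} g = p" and le: "\<And>x. H (g x) + V x \<le> c'"
  shows "c \<le> c'"
proof -
  define w where "w = (\<lambda>x. antideriv g x - p * x)"
  have w: "w \<in> C_torus" "C1_with_deriv w (\<lambda>x. g x - p)"
    unfolding w_def using corrector_torus[of g p] corrector_C1[of g p] assms continuous_integrable[OF g(1)]
    by auto
  have v: "v \<in> C_torus" "viscosity_supersolution (\<lambda>q x. H (p + q) + V x - c) v"
    using assms(1) by (auto simp: cell_solution_def viscosity_solution_def)
  \<comment> \<open>A maximum of \<open>w - v\<close> is a minimum of \<open>v - w\<close>, so the
    corrector \<open>w\<close> is itself a test function touching \<open>v\<close> from below at
    \<open>x0\<close>.\<close>
  obtain x0 where x0: "\<And>x. w x - v x \<le> w x0 - v x0"
    using C_torus_attains_max[OF C_torus_diff[OF w(1) v(1)]] by blast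
  have "0 \<le> H (p + (g x0 - p)) + V x0 - c"
    by (rule viscosity_supersolutionD[OF v(2) w(2)]) (use x0 in \<open>auto simp: algebra_simps intro!: always_eventually\<close>)
  then show ?thesis using le[of x0] by simp
qed

lemma cell_constant_ge_if_C1_supersolution:
  assumes "cell_solution H V p c v" and g: "continuous_on UNIV g" "\<And>x. g (x + 1) = g x"
    and "integral {0..1} g = p" and le: "\<And>x. c' \<le> H (g x) + V x"
  shows "c' \<le> c"
proof -
  define w where "w = (\<lambda>x. antideriv g x - p * x)"
  have w: "w \<in> C_torus" "C1_with_deriv w (\<lambda>x. g x - p)"
    unfolding w_def using corrector_torus[of g p] corrector_C1[of g p] assms continuous_integrable[OF g(1)]
    by auto
  have v: "v \<in> C_torus" "viscosity_subsolution (\<lambda>q x. H (p + q) + V x - c) v"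
    using assms(1) by (auto simp: cell_solution_def viscosity_solution_def)
  obtain x0 where x0: "\<And>x. v x - w x \<le> v x0 - w x0"
    using C_torus_attains_max[OF C_torus_diff[OF v(1) w(1)]] by blast
  have "0 \<ge> H (p + (g x0 - p)) + V x0 - c"
    by (rule viscosity_subsolutionD[OF v(2) w(2)]) (use x0 in \<open>auto intro!: always_eventually\<close>)
  then show ?thesis using le[of x0] by simp
qed

text \<open>The barrier adds a steep quadratic beyond \<open>b\<close>, which keeps the maximum off the right end point.\<close>

lemma viscosity_nonincreasing:
  fixes f :: "real \<Rightarrow> real"
  assumes cont: "continuous_on UNIV f"
    and visc: "\<And>\<phi> \<phi>' x. C1_with_deriv \<phi> \<phi>' \<Longrightarrow> \<forall>\<^sub>F y in nhds x. f y - \<phi> y \<le> f x - \<phi> x \<Longrightarrow> \<phi>' x \<le> 0"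
    and "a \<le> b"
  shows "f b \<le> f a"
proof (rule ccontr)
  assume "\<not> f b \<le> f a"
  then have ab: "f a < f b" "a < b" using \<open>a \<le> b\<close> by (auto simp: less_le)
  \<comment> \<open>Half the mean slope of \<open>f\<close> over \<open>[a, b]\<close>: after
    tilting by it, the value at \<open>b\<close> still exceeds the value at
    \<open>a\<close>.\<close>
  define \<delta> where "\<delta> = ((f b - f a) / 2) / (b - a)"
  have "\<delta> * (b - a) = (f b - f a) / 2" using ab(2) unfolding \<delta>_def by (subst nonzero_eq_divide_eq[symmetric]) auto
  also have "\<dots> < f b - f a" using ab by simp
  finally have "\<delta> * (b - a) < f b - f a" .
  moreover have "0 < \<delta>" using ab by (simp add: \<delta>_def)
  ultimately have \<delta>: "0 < \<delta>" "\<delta> * (b - a) < f b - f a" by auto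
  \<comment> \<open>At \<open>b + 1\<close> the quadratic term equals \<open>L\<close>, which
    cancels any gain of \<open>f\<close> over \<open>f a\<close>. So the maximum over
    \<open>[a, b + 1]\<close> is interior.\<close>
  define L where "L = \<bar>f (b + 1) - f a\<bar>"
  define \<phi> where "\<phi> = (\<lambda>x. \<delta> * (x - a) + L * (max 0 (x - b))^2)"
  define \<phi>' where "\<phi>' = (\<lambda>x. \<delta> + L * (2 * max 0 (x - b)))"
  have sq: "((\<lambda>x. (max 0 (x - b))^2) has_real_derivative 2 * max 0 (x - b)) (at x)" for x
  proof (cases x b rule: linorder_cases)
    case less
    have "((\<lambda>x. 0) has_real_derivative 2 * max 0 (x - b)) (at x)" using less by simp
    then show ?thesis
      by (rule has_field_derivative_transform_within_open[of _ _ _ "{..<b}"]) (use less in auto)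
  next
    case equal
    have "((\<lambda>h. (max 0 (x + h - b))^2 / h) \<longlongrightarrow> 0) (at 0)"
    proof (rule Lim_null_comparison)
      show "\<forall>\<^sub>F h in at 0. norm ((max 0 (x + h - b))^2 / h) \<le> \<bar>h\<bar>"
        using equal by (intro always_eventually) (auto simp: max_def power2_eq_square)
      show "((\<lambda>h::real. \<bar>h\<bar>) \<longlongrightarrow> 0) (at 0)" by (rule tendsto_eq_intros | simp)+
    qed
    then show ?thesis using equal by (simp add: DERIV_def)
  next
    case greater
    have "((\<lambda>x. (x - b)^2) has_real_derivative 2 * max 0 (x - b)) (at x)"
      using greater by (auto intro!: derivative_eq_intros)
    then show ?thesis
      by (rule has_field_derivative_transform_within_open[of _ _ _ "{b<..}"]) (use greater in auto)
  qed
  have C1: "C1_with_deriv \<phi> \<phi>'"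
    unfolding \<phi>_def \<phi>'_def
  proof (rule C1_with_derivI)
    show "((\<lambda>x. \<delta> * (x - a) + L * (max 0 (x - b))^2) has_real_derivative \<delta> + L * (2 * max 0 (x - b))) (at x)" for x
      by (intro DERIV_add DERIV_cmult sq) (auto intro!: derivative_eq_intros)
  qed (intro continuous_intros)
  have "continuous_on {a..b+1} (\<lambda>x. f x - \<phi> x)"
    unfolding \<phi>_def using cont continuous_on_subset by (intro continuous_intros) auto
  then obtain x where x: "x \<in> {a..b+1}" "\<And>y. y \<in> {a..b+1} \<Longrightarrow> f y - \<phi> y \<le> f x - \<phi> x"
    using continuous_attains_sup[of "{a..b+1}" "\<lambda>x. f x - \<phi> x"] ab by auto
  have *: "f b - \<phi> b > f a" using \<delta> by (simp add: \<phi>_def)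
  have "x \<noteq> a" using x(2)[of b] * ab by (auto simp: \<phi>_def)
  moreover have "x \<noteq> b + 1"
  proof
    assume "x = b + 1"
    then have "f a < f (b+1) - \<phi> (b+1)" using x(2)[of b] * ab by auto
    moreover have "f (b+1) - \<phi> (b+1) \<le> f (b + 1) - L"
      using \<delta> ab by (simp add: \<phi>_def)
    ultimately show False by (simp add: L_def)
  qed
  ultimately have "x \<in> {a<..<b+1}" using x(1) by auto
  then have "\<forall>\<^sub>F y in nhds x. y \<in> {a<..<b+1}"
    by (intro eventually_nhds_in_open) auto
  then have "\<forall>\<^sub>F y in nhds x. f y - \<phi> y \<le> f x - \<phi> x"
    by eventually_elim (use x(2) in auto)
  then have "\<phi>' x \<le> 0" using visc C1 by blast
  moreover have "\<phi>' x > 0" using \<delta>(1) by (auto simp: \<phi>'_def L_def intro!: add_pos_nonneg)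
  ultimately show False by simp
qed

text \<open>A continuous function may have no test function from above at a given point. Subtracting
  a steep parabola centred at \<open>x0\<close> produces a local maximum nearby, so the touching
  points are dense.\<close>

lemma touching_point_near:
  fixes v :: "real \<Rightarrow> real"
  assumes "continuous_on UNIV v" "0 < d"
  obtains x \<phi> \<phi>' where "\<bar>x - x0\<bar> < d" "C1_with_deriv \<phi> \<phi>'" "\<forall>\<^sub>F y in nhds x. v y - \<phi> y \<le> v x - \<phi> x"
proof -
  \<comment> \<open>\<open>K * d^2\<close> exceeds the increments of \<open>v\<close> from
    \<open>x0\<close> to both end points, which therefore lose against the centre.\<close>
  define K where "K = (\<bar>v (x0 - d) - v x0\<bar> + \<bar>v (x0 + d) - v x0\<bar> + 1) / d^2"
  have K: "K * d^2 > v (x0 - d) - v x0" "K * d^2 > v (x0 + d) - v x0"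
    using assms(2) by (auto simp: K_def)
  define \<phi> where "\<phi> = (\<lambda>x. K * (x - x0)^2)"
  have C1: "C1_with_deriv \<phi> (\<lambda>x. K * (2 * (x - x0)))"
    unfolding \<phi>_def by (rule C1_with_derivI) (auto intro!: derivative_eq_intros continuous_intros)
  have "continuous_on {x0-d..x0+d} (\<lambda>x. v x - \<phi> x)"
    unfolding \<phi>_def using assms continuous_on_subset by (intro continuous_intros) auto
  then obtain x where x: "x \<in> {x0-d..x0+d}" "\<And>y. y \<in> {x0-d..x0+d} \<Longrightarrow> v y - \<phi> y \<le> v x - \<phi> x"
    using continuous_attains_sup[of "{x0-d..x0+d}" "\<lambda>x. v x - \<phi> x"] assms(2) by auto
  have "x \<noteq> x0 - d" "x \<noteq> x0 + d" using x(2)[of x0] K assms(2) by (auto simp: \<phi>_def)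
  then have in': "x \<in> {x0-d<..<x0+d}" using x(1) by auto
  then have "\<forall>\<^sub>F y in nhds x. y \<in> {x0-d<..<x0+d}"
    by (intro eventually_nhds_in_open) auto
  then have "\<forall>\<^sub>F y in nhds x. v y - \<phi> y \<le> v x - \<phi> x"
    by eventually_elim (use x(2) in auto)
  then show ?thesis using that[OF _ C1, of x] in' by (auto simp: abs_less_iff)
qed

section \<open>Composition with a potential, and equal distribution\<close>

lemma continuous_compose_torus:
  assumes "V \<in> C_torus" "continuous_on UNIV f"
  shows "continuous_on UNIV (\<lambda>x. f (c - V x))"
  by (intro continuous_on_compose2[OF assms(2)] continuous_on_diff continuous_on_const
      C_torus_continuous[OF assms(1)]) auto

lemma same_distributionD:
  assumes "same_distribution V1 V2" "continuous_on UNIV f"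
  shows "integral {0..1} (\<lambda>x. f (V1 x)) = integral {0..1} (\<lambda>x. f (V2 x) :: real)"
  using assms by (simp add: same_distribution_def)

text \<open>Tested with the positive part of \<open>t - K\<close>: a nonnegative continuous function
  with zero integral vanishes. Thus the maximum of a potential is determined by its
  distribution.\<close>

lemma same_distribution_upper_bound:
  assumes "V1 \<in> C_torus" "V2 \<in> C_torus" "same_distribution V1 V2" "\<And>x. V1 x \<le> K"
  shows "V2 x \<le> K"
proof -
  have "integral {0..1} (\<lambda>x. max 0 (V2 x - K)) = integral {0..1} (\<lambda>x. max 0 (V1 x - K))"
    by (rule same_distributionD[OF assms(3), symmetric, where f = "\<lambda>t. max 0 (t - K)"]) (intro continuous_intros)
  also have "\<dots> = 0" proof -
    have "max 0 (V1 x - K) = 0" for x using assms(4)[of x] by simp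
    then show ?thesis by simp
  qed
  finally have 0: "integral {0..1} (\<lambda>x. max 0 (V2 x - K)) = 0" .
  have "continuous_on {0..1} V2" using C_torus_continuous[OF assms(2)] continuous_on_subset by blast
  then have "continuous_on {0..1} (\<lambda>x. max 0 (V2 x - K))" by (intro continuous_intros)
  then have "\<forall>x\<in>{0..1}. max 0 (V2 x - K) = 0"
    using integral_eq_0_iff[of 0 1 "\<lambda>x. max 0 (V2 x - K)"] 0 by simp
  then have "max 0 (V2 (frac x) - K) = 0" by (simp add: frac_lt_1 less_imp_le)
  then show ?thesis using periodic_frac[of V2 x, OF C_torus_periodic[OF assms(2)]] by simp
qed

lemma compose_torus_borel:
  fixes f :: "real \<Rightarrow> real"
  assumes "V \<in> C_torus" "mono f"
  shows "(\<lambda>x. f (c - V x)) \<in> borel_measurable borel"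
proof -
  have "(\<lambda>x. c - V x) \<in> borel_measurable borel"
    by (intro borel_measurable_continuous_onI continuous_intros C_torus_continuous[OF assms(1)])
  then show ?thesis
    using measurable_compose[OF _ borel_measurable_mono[OF assms(2)]] by blast
qed

text \<open>Uniformity over the levels within 1 of \<open>c\<close> supplies the dominating constant
  for limits along \<open>c + 1 / real (Suc n)\<close> and
  \<open>c - 1 / real (Suc n)\<close>.\<close>

lemma compose_torus_bounded:
  fixes f :: "real \<Rightarrow> real"
  assumes "V \<in> C_torus" "mono f"
  obtains K where "\<And>x c'. \<bar>c' - c\<bar> \<le> 1 \<Longrightarrow> \<bar>f (c' - V x)\<bar> \<le> K"
proof -
  obtain M where M: "\<And>x. \<bar>V x\<bar> \<le> M" using C_torus_bounded[OF assms(1)] by blast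
  have "\<bar>f (c' - V x)\<bar> \<le> \<bar>f (c - 1 - M)\<bar> + \<bar>f (c + 1 + M)\<bar>" if "\<bar>c' - c\<bar> \<le> 1" for x c'
  proof -
    have "f (c - 1 - M) \<le> f (c' - V x)" "f (c' - V x) \<le> f (c + 1 + M)"
      using M[of x] that by (intro monoD[OF assms(2)]; linarith)+
    then show ?thesis by linarith
  qed
  then show ?thesis by (rule that)
qed

lemma compose_torus_integrable:
  fixes f :: "real \<Rightarrow> real"
  assumes "V \<in> C_torus" "mono f"
  shows "(\<lambda>x. f (c - V x)) integrable_on {a..b}"
proof -
  obtain K where "\<And>x c'. \<bar>c' - c\<bar> \<le> 1 \<Longrightarrow> \<bar>f (c' - V x)\<bar> \<le> K"
    using compose_torus_bounded[OF assms] by blast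
  then show ?thesis
    by (intro bounded_borel_integrable[of _ K] compose_torus_borel assms) auto
qed

lemma inverse_Suc_le_1: "1 / real (Suc n) \<le> 1" "0 < 1 / real (Suc n)"
  by auto

lemma quasi_convexD:
  assumes "quasi_convex H" "H x \<le> s" "H y \<le> s" "x \<le> z" "z \<le> y"
  shows "H z \<le> s"
proof -
  have "is_interval {q. H q \<le> s}" using assms(1) by (simp add: quasi_convex_def is_interval_convex_1)
  then show ?thesis using assms unfolding is_interval_1 by blast
qed

section \<open>One-sided slopes and touching test functions\<close>

lemma antideriv_slope_le:
  assumes "\<And>a b. g integrable_on {a..b}" "a < b" "\<And>x. a < x \<Longrightarrow> x < b \<Longrightarrow> g x \<le> B"
  shows "antideriv g b - antideriv g a \<le> B * (b - a)"
  using antideriv_diff[OF assms(1), of a b] integral_le_open[OF assms(1), of a b B] assms(2,3) by simp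

lemma antideriv_slope_ge:
  assumes "\<And>a b. g integrable_on {a..b}" "a < b" "\<And>x. a < x \<Longrightarrow> x < b \<Longrightarrow> B \<le> g x"
  shows "B * (b - a) \<le> antideriv g b - antideriv g a"
  using antideriv_diff[OF assms(1), of a b] integral_ge_open[OF assms(1), of a b B] assms(2,3) by simp

text \<open>If \<open>\<phi>\<close> touches \<open>v\<close> from above at \<open>y\<close>, its
  left difference quotients are at most those of \<open>v\<close> and its right ones at least those
  of \<open>v\<close>. Touching from below reverses both comparisons.\<close>

lemma
  fixes \<phi> v :: "real \<Rightarrow> real"
  assumes d: "(\<phi> has_real_derivative d) (at y)"
  shows touching_above_left:
      "\<lbrakk>\<forall>\<^sub>F x in nhds y. v x - \<phi> x \<le> v y - \<phi> y; \<forall>\<^sub>F x in at_left y. v y - v x \<le> B * (y - x)\<rbrakk> \<Longrightarrow> d \<le> B"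
    and touching_above_right:
      "\<lbrakk>\<forall>\<^sub>F x in nhds y. v x - \<phi> x \<le> v y - \<phi> y; \<forall>\<^sub>F x in at_right y. B * (x - y) \<le> v x - v y\<rbrakk> \<Longrightarrow> B \<le> d"
    and touching_below_left:
      "\<lbrakk>\<forall>\<^sub>F x in nhds y. v x - \<phi> x \<ge> v y - \<phi> y; \<forall>\<^sub>F x in at_left y. B * (y - x) \<le> v y - v x\<rbrakk> \<Longrightarrow> B \<le> d"
    and touching_below_right:
      "\<lbrakk>\<forall>\<^sub>F x in nhds y. v x - \<phi> x \<ge> v y - \<phi> y; \<forall>\<^sub>F x in at_right y. v x - v y \<le> B * (x - y)\<rbrakk> \<Longrightarrow> d \<le> B"
proof -
  have n: "\<forall>\<^sub>F x in at y within S. P x" if "\<forall>\<^sub>F x in nhds y. P x" for P S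
    unfolding eventually_at_filter by (rule eventually_mono[OF that]) simp
  have neg: "B * (x - y) = - (B * (y - x))" for x by (simp add: right_diff_distrib)
  have l: "\<forall>\<^sub>F x in at_left y. x < y" and r: "\<forall>\<^sub>F x in at_right y. y < x"
    by (simp_all add: eventually_at_filter)
  {
    assume a1: "\<forall>\<^sub>F x in nhds y. v x - \<phi> x \<le> v y - \<phi> y" and a2: "\<forall>\<^sub>F x in at_left y. v y - v x \<le> B * (y - x)"
    have "\<forall>\<^sub>F x in at_left y. x < y \<and> v x - \<phi> x \<le> v y - \<phi> y \<and> v y - v x \<le> B * (y - x)"
      using eventually_conj[OF l eventually_conj[OF n[OF a1] a2]] .
    then have "\<forall>\<^sub>F x in at_left y. (\<phi> x - \<phi> y) / (x - y) \<le> B"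
      by (rule eventually_mono) (use neg in \<open>simp add: neg_divide_le_eq\<close>)
    then show "d \<le> B" by (rule derivative_le_if_slope_le[OF d trivial_limit_at_left_real])
  }
  {
    assume a1: "\<forall>\<^sub>F x in nhds y. v x - \<phi> x \<le> v y - \<phi> y" and a2: "\<forall>\<^sub>F x in at_right y. B * (x - y) \<le> v x - v y"
    have "\<forall>\<^sub>F x in at_right y. y < x \<and> v x - \<phi> x \<le> v y - \<phi> y \<and> B * (x - y) \<le> v x - v y"
      using eventually_conj[OF r eventually_conj[OF n[OF a1] a2]] .
    then have "\<forall>\<^sub>F x in at_right y. (\<phi> x - \<phi> y) / (x - y) \<ge> B"
      by (rule eventually_mono) (use neg in \<open>simp add: pos_le_divide_eq\<close>)
    then show "B \<le> d" by (rule derivative_ge_if_slope_ge[OF d trivial_limit_at_right_real])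
  }
  {
    assume a1: "\<forall>\<^sub>F x in nhds y. v x - \<phi> x \<ge> v y - \<phi> y" and a2: "\<forall>\<^sub>F x in at_left y. B * (y - x) \<le> v y - v x"
    have "\<forall>\<^sub>F x in at_left y. x < y \<and> v x - \<phi> x \<ge> v y - \<phi> y \<and> B * (y - x) \<le> v y - v x"
      using eventually_conj[OF l eventually_conj[OF n[OF a1] a2]] .
    then have "\<forall>\<^sub>F x in at_left y. (\<phi> x - \<phi> y) / (x - y) \<ge> B"
      by (rule eventually_mono) (use neg in \<open>simp add: neg_le_divide_eq\<close>)
    then show "B \<le> d" by (rule derivative_ge_if_slope_ge[OF d trivial_limit_at_left_real])
  }
  {
    assume a1: "\<forall>\<^sub>F x in nhds y. v x - \<phi> x \<ge> v y - \<phi> y" and a2: "\<forall>\<^sub>F x in at_right y. v x - v y \<le> B * (x - y)"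
    have "\<forall>\<^sub>F x in at_right y. y < x \<and> v x - \<phi> x \<ge> v y - \<phi> y \<and> v x - v y \<le> B * (x - y)"
      using eventually_conj[OF r eventually_conj[OF n[OF a1] a2]] .
    then have "\<forall>\<^sub>F x in at_right y. (\<phi> x - \<phi> y) / (x - y) \<le> B"
      by (rule eventually_mono) (use neg in \<open>simp add: pos_divide_le_eq\<close>)
    then show "d \<le> B" by (rule derivative_le_if_slope_le[OF d trivial_limit_at_right_real])
  }
qed

lemma isCont_real_obtain:
  fixes f :: "real \<Rightarrow> real"
  assumes "isCont f x" "0 < e"
  obtains d where "0 < d" "\<And>y. \<bar>y - x\<bar> \<le> d \<Longrightarrow> \<bar>f y - f x\<bar> < e"
proof -
  obtain d where d: "d > 0" "\<And>y. dist y x < d \<Longrightarrow> dist (f y) (f x) < e"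
    using assms unfolding continuous_at_eps_delta by blast
  show ?thesis by (rule that[of "d/2"]) (use d in \<open>auto simp: dist_real_def\<close>)
qed

text \<open>At a downward kink no \<open>C\<^sup>1\<close> function touches from below, so that one-sided control of the
  slope \<open>g\<close> suffices for the supersolution property.\<close>

lemma cell_solution_of_slope:
  fixes H V g :: "real \<Rightarrow> real"
  assumes H: "continuous_on UNIV H" "quasi_convex H" and V: "V \<in> C_torus"
    and int: "\<And>a b. g integrable_on {a..b}" and per: "\<And>x. g (x + 1) = g x"
    and p: "integral {0..1} g = p"
    and sub: "\<And>x. H (g x) \<le> c - V x"
    and super: "\<And>y. (\<forall>q. c - V y \<le> H q) \<or>
       (\<forall>\<^sub>F x in at_left y. \<forall>q. H q < c - V x \<longrightarrow> q \<le> g x) \<or>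
       (\<forall>\<^sub>F x in at_right y. \<forall>q. H q < c - V x \<longrightarrow> g x \<le> q)"
  shows "cell_solution H V p c (\<lambda>x. antideriv g x - p * x)"
proof -
  define v where "v = (\<lambda>x. antideriv g x - p * x)"
  have contH: "isCont H q" for q using H(1) continuous_on_eq_continuous_at open_UNIV by blast
  have contV: "isCont V x" for x by (rule C_torus_isCont[OF V])
  have v_le: "v b - v a \<le> (B - p) * (b - a)"
    if "a < b" "\<And>x. a < x \<Longrightarrow> x < b \<Longrightarrow> g x \<le> B" for a b B
    using antideriv_slope_le[OF int that] by (simp add: v_def algebra_simps)
  have v_ge: "(B - p) * (b - a) \<le> v b - v a"
    if "a < b" "\<And>x. a < x \<Longrightarrow> x < b \<Longrightarrow> B \<le> g x" for a b B
    using antideriv_slope_ge[OF int that] by (simp add: v_def algebra_simps)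
  have sub': "H (p + \<phi>' y) + V y - c \<le> 0"
    if \<phi>: "C1_with_deriv \<phi> \<phi>'" and t: "\<forall>\<^sub>F x in nhds y. v x - \<phi> x \<le> v y - \<phi> y" for \<phi> \<phi>' y
  proof (rule ccontr)
    have D: "(\<phi> has_real_derivative \<phi>' y) (at y)" using \<phi> by (simp add: C1_with_deriv_def)
    define q where "q = p + \<phi>' y"
    assume "\<not> ?thesis"
    \<comment> \<open>Half of the excess: one share \<open>e\<close> pays for the variation of
      \<open>V\<close> near \<open>y\<close>, the other for that of \<open>H\<close> near
      \<open>q\<close>.\<close>
    define e where "e = (H q + V y - c) / 2"
    have e: "0 < e" using \<open>\<not> _\<close> by (simp add: e_def q_def)
    obtain \<eta> where \<eta>: "0 < \<eta>" "\<And>z. \<bar>z - q\<bar> \<le> \<eta> \<Longrightarrow> \<bar>H z - H q\<bar> < e"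
      using isCont_real_obtain[OF contH e] by blast
    obtain d where d: "0 < d" "\<And>x. \<bar>x - y\<bar> \<le> d \<Longrightarrow> \<bar>V x - V y\<bar> < e"
      using isCont_real_obtain[OF contV e] by blast
    have gsub: "H (g x) < H q - e" if "\<bar>x - y\<bar> \<le> d" for x
      proof -
      have "2 * e = H q + V y - c" by (simp add: e_def)
      then show ?thesis using sub[of x] d(2)[OF that] unfolding abs_less_iff by linarith
    qed
    have nq: "\<not> \<bar>g x - q\<bar> \<le> \<eta>" if "\<bar>x - y\<bar> \<le> d" for x
      using gsub[OF that] \<eta>(2)[of "g x"] by (auto simp: abs_if split: if_splits)
    \<comment> \<open>Near \<open>y\<close> the slope \<open>g\<close> takes values in the sublevel
      set of \<open>H\<close> at the level \<open>H q - e\<close>. By quasi-convexity this set is an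
      interval; it misses \<open>q\<close>, so \<open>g\<close> stays on one side of
      \<open>q\<close>, with a gap of \<open>\<eta>\<close>.\<close>
    have "(\<forall>x. \<bar>x - y\<bar> \<le> d \<longrightarrow> g x \<le> q - \<eta>) \<or> (\<forall>x. \<bar>x - y\<bar> \<le> d \<longrightarrow> q + \<eta> \<le> g x)"
    proof (rule ccontr)
      assume "\<not> ?thesis"
      then obtain x1 x2 where x: "\<bar>x1 - y\<bar> \<le> d" "g x1 > q - \<eta>" "\<bar>x2 - y\<bar> \<le> d" "g x2 < q + \<eta>"
        by (auto simp: not_le)
      then have "g x1 > q" "g x2 < q" using nq[of x1] nq[of x2] by (auto simp: abs_if split: if_splits)
      then have "H q \<le> H q - e"
        using quasi_convexD[OF H(2), of "g x2" "H q - e" "g x1" q] gsub[of x1] gsub[of x2] x by simp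
      then show False using e by simp
    qed
    then show False
    proof
      assume le: "\<forall>x. \<bar>x - y\<bar> \<le> d \<longrightarrow> g x \<le> q - \<eta>"
      have "\<forall>\<^sub>F x in at_left y. x \<in> {y-d<..<y}"
        using d(1) by (intro eventually_at_leftI[of "y-d"]) auto
      then have "\<forall>\<^sub>F x in at_left y. v y - v x \<le> (q - \<eta> - p) * (y - x)"
        by eventually_elim (intro v_le, use le in auto)
      then have "\<phi>' y \<le> q - \<eta> - p" by (rule touching_above_left[OF D t])
      then show False using \<eta>(1) by (simp add: q_def)
    next
      assume le: "\<forall>x. \<bar>x - y\<bar> \<le> d \<longrightarrow> q + \<eta> \<le> g x"
      have "\<forall>\<^sub>F x in at_right y. x \<in> {y<..<y+d}"
        using d(1) by (intro eventually_at_rightI[of y "y+d"]) auto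
      then have "\<forall>\<^sub>F x in at_right y. (q + \<eta> - p) * (x - y) \<le> v x - v y"
        by eventually_elim (intro v_ge, use le in auto)
      then have "q + \<eta> - p \<le> \<phi>' y" by (rule touching_above_right[OF D t])
      then show False using \<eta>(1) by (simp add: q_def)
    qed
  qed
  have super': "H (p + \<phi>' y) + V y - c \<ge> 0"
    if \<phi>: "C1_with_deriv \<phi> \<phi>'" and t: "\<forall>\<^sub>F x in nhds y. v x - \<phi> x \<ge> v y - \<phi> y" for \<phi> \<phi>' y
  proof (rule ccontr)
    have D: "(\<phi> has_real_derivative \<phi>' y) (at y)" using \<phi> by (simp add: C1_with_deriv_def)
    define q where "q = p + \<phi>' y"
    assume neg: "\<not> ?thesis"
    define e where "e = (c - V y - H q) / 2"
    have e: "0 < e" using neg by (simp add: e_def q_def)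
    obtain \<eta> where \<eta>: "0 < \<eta>" "\<And>z. \<bar>z - q\<bar> \<le> \<eta> \<Longrightarrow> \<bar>H z - H q\<bar> < e"
      using isCont_real_obtain[OF contH e] by blast
    obtain d where d: "0 < d" "\<And>x. \<bar>x - y\<bar> \<le> d \<Longrightarrow> \<bar>V x - V y\<bar> < e"
      using isCont_real_obtain[OF contV e] by blast
    have lt: "H z < c - V x" if "\<bar>x - y\<bar> \<le> d" "\<bar>z - q\<bar> \<le> \<eta>" for x z
      proof -
      have "2 * e = c - V y - H q" by (simp add: e_def)
      then show ?thesis using \<eta>(2)[OF that(2)] d(2)[OF that(1)] unfolding abs_less_iff by linarith
    qed
    \<comment> \<open>The slope \<open>q\<close> itself violates the first alternative of
      \<open>super\<close>, which leaves the two one-sided ones.\<close>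
    have "\<not> (\<forall>q. c - V y \<le> H q)" using neg by (auto simp: q_def[symmetric] not_le intro!: exI[of _ q])
    then consider "\<forall>\<^sub>F x in at_left y. \<forall>q. H q < c - V x \<longrightarrow> q \<le> g x"
      | "\<forall>\<^sub>F x in at_right y. \<forall>q. H q < c - V x \<longrightarrow> g x \<le> q"
      using super by blast
    then show False
    proof cases
      case 1
      then obtain b where b: "b < y" "\<And>x. b < x \<Longrightarrow> x < y \<Longrightarrow> \<forall>q. H q < c - V x \<longrightarrow> q \<le> g x"
        using eventually_at_left[of "y-1" y] by auto
      \<comment> \<open>Even \<open>q + \<eta>\<close> lies in the strict sublevel set at
        \<open>x\<close>. So \<open>v\<close> rises to the left of \<open>y\<close> with slope at
        least \<open>\<phi>' y + \<eta>\<close>, too steep for touching from below.\<close>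
      have ge: "q + \<eta> \<le> g x" if "max b (y-d) < x" "x < y" for x
        using b(2)[of x] lt[of x "q+\<eta>"] that \<eta>(1) by auto
      have "\<forall>\<^sub>F x in at_left y. x \<in> {max b (y-d)<..<y}"
        using d(1) b(1) by (intro eventually_at_leftI[of "max b (y-d)"]) auto
      then have "\<forall>\<^sub>F x in at_left y. (q + \<eta> - p) * (y - x) \<le> v y - v x"
        by eventually_elim (intro v_ge, use ge in auto)
      then have "q + \<eta> - p \<le> \<phi>' y" by (rule touching_below_left[OF D t])
      then show False using \<eta>(1) by (simp add: q_def)
    next
      case 2
      then obtain b where b: "y < b" "\<And>x. y < x \<Longrightarrow> x < b \<Longrightarrow> \<forall>q. H q < c - V x \<longrightarrow> g x \<le> q"
        using eventually_at_right[of y "y+1"] by auto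
      have le: "g x \<le> q - \<eta>" if "y < x" "x < min b (y+d)" for x
        using b(2)[of x] lt[of x "q-\<eta>"] that \<eta>(1) by auto
      have "\<forall>\<^sub>F x in at_right y. x \<in> {y<..<min b (y+d)}"
        using d(1) b(1) by (intro eventually_at_rightI[of y "min b (y+d)"]) auto
      then have "\<forall>\<^sub>F x in at_right y. v x - v y \<le> (q - \<eta> - p) * (x - y)"
        by eventually_elim (intro v_le, use le in auto)
      then have "\<phi>' y \<le> q - \<eta> - p" by (rule touching_below_right[OF D t])
      then show False using \<eta>(1) by (simp add: q_def)
    qed
  qed
  have vT: "v \<in> C_torus" unfolding v_def using corrector_torus[OF int per p] .
  show ?thesis
    unfolding v_def[symmetric]
  proof (rule cell_solutionI[OF vT])
    fix \<phi> \<phi>' y assume \<phi>: "C1_with_deriv \<phi> \<phi>'"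
    show "H (p + \<phi>' y) + V y - c \<le> 0" if "\<forall>\<^sub>F x in nhds y. v x - \<phi> x \<le> v y - \<phi> y"
      by (rule sub'[OF \<phi> that])
    show "H (p + \<phi>' y) + V y - c \<ge> 0" if "\<forall>\<^sub>F x in nhds y. v x - \<phi> x \<ge> v y - \<phi> y"
      by (rule super'[OF \<phi> that])
  qed
qed

text \<open>The reflection \<open>x \<mapsto> - x\<close> changes the sign of slopes and of
  \<open>p\<close>. It exchanges the two branches of \<open>H\<close>, so that results for the upper
  branch transfer to the lower one.\<close>

lemma cell_solution_reflect:
  assumes "cell_solution (\<lambda>q. H (-q)) (\<lambda>x. V (-x)) (-p) c v"
  shows "cell_solution H V p c (\<lambda>x. v (-x))"
proof -
  have v: "v \<in> C_torus" using assms by (simp add: cell_solution_def)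
  have vC: "(\<lambda>x. v (-x)) \<in> C_torus" by (rule C_torus_reflect[OF v])
  have C1: "C1_with_deriv (\<lambda>x. \<phi> (-x)) (\<lambda>x. - \<phi>' (-x))" if "C1_with_deriv \<phi> \<phi>'" for \<phi> \<phi>'
  proof (rule C1_with_derivI)
    show "((\<lambda>x. \<phi> (-x)) has_real_derivative - \<phi>' (-x)) (at x)" for x
      using that DERIV_mirror[of \<phi> "\<phi>' (-x)" x] by (simp add: C1_with_deriv_def)
    have "continuous_on UNIV \<phi>'" using that by (simp add: C1_with_deriv_def)
    then show "continuous_on UNIV (\<lambda>x. - \<phi>' (-x))"
      by (intro continuous_on_minus continuous_on_compose2[of UNIV \<phi>' UNIV uminus] continuous_on_id) auto
  qed
  have ev: "\<forall>\<^sub>F x in nhds (-y). P (-x)" if PP: "\<forall>\<^sub>F x in nhds y. P x" for P and y :: real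
  proof -
    obtain e where e: "0 < e" "\<And>x. dist x y < e \<Longrightarrow> P x"
      using PP unfolding eventually_nhds_metric by blast
    have "P (-x)" if "dist x (-y) < e" for x
      using that by (intro e(2)) (simp add: dist_real_def abs_if split: if_splits)
    then show ?thesis unfolding eventually_nhds_metric using e(1) by blast
  qed
  show ?thesis
  proof (rule cell_solutionI[OF vC])
    fix \<phi> \<phi>' y assume \<phi>: "C1_with_deriv \<phi> \<phi>'"
    show "H (p + \<phi>' y) + V y - c \<le> 0" if "\<forall>\<^sub>F x in nhds y. v (-x) - \<phi> x \<le> v (-y) - \<phi> y"
      using viscosity_subsolutionD[OF cell_solutionD(2)[OF assms] C1[OF \<phi>], of "-y"] ev[OF that] by (simp add: add.commute)
    show "H (p + \<phi>' y) + V y - c \<ge> 0" if "\<forall>\<^sub>F x in nhds y. v (-x) - \<phi> x \<ge> v (-y) - \<phi> y"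
      using viscosity_supersolutionD[OF cell_solutionD(3)[OF assms] C1[OF \<phi>], of "-y"] ev[OF that] by (simp add: add.commute)
  qed
qed

section \<open>Quasi-convex Hamiltonians\<close>

text \<open>Inserting the minimiser \<open>q0\<close> of \<open>H\<close> keeps the supremum meaningful and monotone for levels below \<open>min H\<close>.\<close>

definition upper_root :: "(real \<Rightarrow> real) \<Rightarrow> real \<Rightarrow> real \<Rightarrow> real" where
  "upper_root H q0 s = Sup (insert q0 {q. H q \<le> s})"

text \<open>For the Hamiltonians considered below this is the left limit of
  \<open>upper_root\<close> at \<open>s\<close>. A gap between the two comes from a flat piece of
  \<open>H\<close> at the level \<open>s\<close>.\<close>

definition strict_upper_root :: "(real \<Rightarrow> real) \<Rightarrow> real \<Rightarrow> real \<Rightarrow> real" where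
  "strict_upper_root H q0 s = Sup (insert q0 {q. H q < s})"

text \<open>Equals the infimum of the sublevel set with \<open>q0\<close> inserted. The reflected
  form lets its properties be read off from those of \<open>upper_root\<close>.\<close>

definition lower_root :: "(real \<Rightarrow> real) \<Rightarrow> real \<Rightarrow> real \<Rightarrow> real" where
  "lower_root H q0 s = - upper_root (\<lambda>q. H (- q)) (- q0) s"

locale qc_hamiltonian =
  fixes H :: "real \<Rightarrow> real" and q0 :: real
  assumes cont: "continuous_on UNIV H" and coer: "coercive H" and qc: "quasi_convex H"
    and min: "\<And>q. H q0 \<le> H q"

lemma coercive_sublevel_bounded:
  assumes "coercive H"
  obtains R where "0 < R" "\<And>q. H q \<le> s \<Longrightarrow> \<bar>q\<bar> \<le> R"
proof -
  have "\<forall>\<^sub>F q in at_infinity. s < H q"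
    using assms unfolding coercive_def filterlim_at_top_dense by blast
  then obtain b where b: "\<And>q. b \<le> \<bar>q\<bar> \<Longrightarrow> s < H q"
    unfolding eventually_at_infinity by auto
  show ?thesis
  proof (rule that[of "\<bar>b\<bar> + 1"])
    show "\<bar>q\<bar> \<le> \<bar>b\<bar> + 1" if "H q \<le> s" for q using b[of q] that by linarith
  qed simp
qed

lemma coercive_attains_min:
  assumes "continuous_on UNIV H" "coercive H"
  obtains q0 where "\<And>q. H q0 \<le> H (q::real)"
proof -
  obtain R where R: "0 < R" "\<And>q. H q \<le> H 0 \<Longrightarrow> \<bar>q\<bar> \<le> R"
    using coercive_sublevel_bounded[OF assms(2)] by blast
  have "continuous_on {-R..R} H" using assms(1) continuous_on_subset by blast
  then obtain q0 where q0: "q0 \<in> {-R..R}" "\<And>q. q \<in> {-R..R} \<Longrightarrow> H q0 \<le> H q"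
    using continuous_attains_inf[of "{-R..R}" H] R(1) by force
  have "H q0 \<le> H q" for q
  proof (cases "\<bar>q\<bar> \<le> R")
    case True
    then show ?thesis by (intro q0(2)) auto
  next
    case False
    then have "H 0 \<le> H q" using R(2)[of q] by linarith
    then show ?thesis using q0(2)[of 0] R(1) by auto
  qed
  then show ?thesis by (rule that)
qed

context qc_hamiltonian
begin

abbreviation "up \<equiv> upper_root H q0"
abbreviation "left \<equiv> strict_upper_root H q0"
abbreviation "lo \<equiv> lower_root H q0"

section \<open>Roots of the Hamiltonian as functions of the level\<close>

lemma bdd_above_sublevels: "bdd_above (insert q0 {q. H q \<le> s})" "bdd_above (insert q0 {q. H q < s})"
proof -
  obtain R where R: "\<And>q. H q \<le> s \<Longrightarrow> \<bar>q\<bar> \<le> R"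
    using coercive_sublevel_bounded[OF coer, of s] by metis
  have "x \<le> R" if "H x \<le> s" for x using R[OF that] by linarith
  then have "bdd_above {q. H q \<le> s}" "bdd_above {q. H q < s}"
    by (auto intro!: bdd_aboveI[of _ R])
  then show "bdd_above (insert q0 {q. H q \<le> s})" "bdd_above (insert q0 {q. H q < s})" by auto
qed

lemma le_up: "H q \<le> s \<Longrightarrow> q \<le> up s"
  unfolding upper_root_def by (rule cSup_upper[OF _ bdd_above_sublevels(1)]) simp

lemma q0_le_up: "q0 \<le> up s"
  unfolding upper_root_def by (rule cSup_upper[OF _ bdd_above_sublevels(1)]) simp

lemma le_left: "H q < s \<Longrightarrow> q \<le> left s"
  unfolding strict_upper_root_def by (rule cSup_upper[OF _ bdd_above_sublevels(2)]) simp

lemma q0_le_left: "q0 \<le> left s"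
  unfolding strict_upper_root_def by (rule cSup_upper[OF _ bdd_above_sublevels(2)]) simp

lemma left_le_up: "left s \<le> up s"
  unfolding upper_root_def strict_upper_root_def by (rule cSup_subset_mono[OF _ bdd_above_sublevels(1)]) auto

lemma up_le_left: "s < t \<Longrightarrow> up s \<le> left t"
  unfolding upper_root_def strict_upper_root_def by (rule cSup_subset_mono[OF _ bdd_above_sublevels(2)]) auto

lemma mono_up: "mono up"
  unfolding upper_root_def by (rule monoI, rule cSup_subset_mono[OF _ bdd_above_sublevels(1)]) auto

lemma mono_left: "mono left"
  unfolding strict_upper_root_def by (rule monoI, rule cSup_subset_mono[OF _ bdd_above_sublevels(2)]) auto

lemma H_up: assumes "H q0 \<le> s" shows "H (up s) \<le> s"
proof -
  have "insert q0 {q. H q \<le> s} = {q. H q \<le> s}" using assms by auto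
  moreover have "closed {q. H q \<le> s}"
    by (intro closed_Collect_le cont continuous_intros)
  moreover have "Sup {q. H q \<le> s} \<in> {q. H q \<le> s}"
    using calculation bdd_above_sublevels(1)[of s] assms by (intro closed_contains_Sup) auto
  ultimately show ?thesis by (simp add: upper_root_def)
qed

lemma H_between_q0_up:
  assumes "H q0 \<le> s" "q0 \<le> q" "q \<le> up s"
  shows "H q \<le> s"
  using quasi_convexD[OF qc assms(1) H_up[OF assms(1)] assms(2,3)] .

lemma reflect: "qc_hamiltonian (\<lambda>q. H (- q)) (- q0)"
proof
  show "continuous_on UNIV (\<lambda>q. H (- q))"
    by (intro continuous_on_compose2[OF cont] continuous_on_minus continuous_on_id) auto
  show "coercive (\<lambda>q. H (- q))"
    using coer unfolding coercive_def
  proof (rule filterlim_compose)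
    show "filterlim (uminus :: real \<Rightarrow> real) at_infinity at_infinity"
      unfolding filterlim_at_infinity_conv_norm_at_top norm_minus_cancel by (rule filterlim_norm_at_top)
  qed
  show "quasi_convex (\<lambda>q. H (- q))"
    unfolding quasi_convex_def is_interval_convex_1[symmetric] is_interval_1
  proof clarsimp
    fix c a b x assume *: "H (- a) \<le> c" "H (- b) \<le> c" "a \<le> x" "x \<le> b"
    show "H (- x) \<le> c" using quasi_convexD[OF qc *(2,1), of "-x"] *(3,4) by simp
  qed
  show "H (- (- q0)) \<le> H (- q)" for q using min by simp
qed

lemma H_between:
  assumes "H q0 \<le> s" "lo s \<le> q" "q \<le> up s"
  shows "H q \<le> s"
proof (cases "q0 \<le> q")
  case True
  then show ?thesis using H_between_q0_up assms by blast
next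
  case False
  then show ?thesis
    using qc_hamiltonian.H_between_q0_up[OF reflect, of s "-q"] assms by (simp add: lower_root_def)
qed

lemma lo_le: "H q \<le> s \<Longrightarrow> lo s \<le> q"
  using qc_hamiltonian.le_up[OF reflect, of "-q" s] by (simp add: lower_root_def)

lemma lo_le_q0: "lo s \<le> q0"
  using qc_hamiltonian.q0_le_up[OF reflect, of s] by (simp add: lower_root_def)

text \<open>\<open>up\<close> may jump, but its mean over \<open>[s, s + e]\<close> is continuous in
  \<open>s\<close> and, by monotonicity, lies between the two end values.\<close>

lemma up_smooth:
  assumes "0 < e"
  obtains f where "continuous_on UNIV f" "\<And>s. up s \<le> f s" "\<And>s. f s \<le> up (s + e)"
proof -
  have int: "up integrable_on {a..b}" for a b
    by (intro integrable_on_mono_on mono_on_subset[OF mono_up]) auto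
  define f where "f = (\<lambda>s. (antideriv up (s + e) - antideriv up s) / e)"
  have A: "continuous_on UNIV (antideriv up)" by (rule continuous_antideriv[OF int])
  have "continuous_on UNIV (\<lambda>s. antideriv up (s + e))"
    by (intro continuous_on_compose2[OF A] continuous_intros) auto
  then have "continuous_on UNIV f"
    unfolding f_def using A assms by (intro continuous_on_divide continuous_on_diff continuous_on_const) auto
  moreover have "up s \<le> f s" "f s \<le> up (s + e)" for s
    using antideriv_slope_ge[OF int, of s "s+e" "up s"] antideriv_slope_le[OF int, of s "s+e" "up (s+e)"]
      monoD[OF mono_up] assms
    by (auto simp: f_def pos_le_divide_eq pos_divide_le_eq)
  ultimately show ?thesis by (rule that)
qed

lemma lo_smooth:
  assumes "0 < e"
  obtains f where "continuous_on UNIV f" "\<And>s. f s \<le> lo s" "\<And>s. lo (s + e) \<le> f s"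
proof -
  obtain f where "continuous_on UNIV f"
    "\<And>s. upper_root (\<lambda>q. H (- q)) (- q0) s \<le> f s" "\<And>s. f s \<le> upper_root (\<lambda>q. H (- q)) (- q0) (s + e)"
    using qc_hamiltonian.up_smooth[OF reflect assms] by blast
  then show ?thesis
    by (intro that[of "\<lambda>s. - f s"]) (auto simp: lower_root_def intro: continuous_on_minus)
qed

section \<open>Bounds on the cell constant and its uniqueness\<close>

lemma cell_constant_ge:
  assumes "V \<in> C_torus" "cell_solution H V p c v"
  shows "H q0 + V x0 \<le> c"
proof (rule ccontr)
  assume neg: "\<not> ?thesis"
  define e where "e = H q0 + V x0 - c"
  have "0 < e" using neg by (simp add: e_def)
  \<comment> \<open>The subsolution inequality is available only at touching points. One within
    distance \<open>d\<close> of \<open>x0\<close> suffices, as \<open>V\<close> changes by less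
    than \<open>e\<close> there.\<close>
  then obtain d where d: "0 < d" "\<And>x. \<bar>x - x0\<bar> \<le> d \<Longrightarrow> \<bar>V x - V x0\<bar> < e"
    using isCont_real_obtain[OF C_torus_isCont[OF assms(1)]] by blast
  obtain x \<phi> \<phi>' where x: "\<bar>x - x0\<bar> < d" "C1_with_deriv \<phi> \<phi>'" "\<forall>\<^sub>F y in nhds x. v y - \<phi> y \<le> v x - \<phi> x"
    using touching_point_near[OF C_torus_continuous[OF cell_solutionD(1)[OF assms(2)]] d(1)] by blast
  have "H (p + \<phi>' x) + V x - c \<le> 0"
    by (rule viscosity_subsolutionD[OF cell_solutionD(2)[OF assms(2)] x(2,3)])
  then show False using min[of "p + \<phi>' x"] d(2)[of x] x(1) by (simp add: e_def abs_less_iff)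
qed

text \<open>In the viscosity sense the slope \<open>p + v'\<close> of a subsolution is at most
  \<open>up (c - V)\<close>, hence at most \<open>f (c - V)\<close>. So \<open>v\<close> minus the
  corrector \<open>w\<close> built from \<open>f\<close> is nonincreasing, and periodicity of
  \<open>v\<close> gives the bound over one period. A continuous majorant \<open>f\<close> makes
  \<open>w\<close> an admissible test function.\<close>

lemma cell_mean_le:
  assumes V: "V \<in> C_torus" and sol: "cell_solution H V p c v"
    and f: "continuous_on UNIV f" "\<And>s. up s \<le> f s"
  shows "p \<le> integral {0..1} (\<lambda>x. f (c - V x))"
proof -
  define g where "g = (\<lambda>x. f (c - V x))"
  define w where "w = (\<lambda>x. antideriv g x - p * x)"
  have g: "continuous_on UNIV g" unfolding g_def by (rule continuous_compose_torus[OF V f(1)])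
  have w: "C1_with_deriv w (\<lambda>x. g x - p)" unfolding w_def by (rule corrector_C1[OF g])
  have vT: "v \<in> C_torus" by (rule cell_solutionD[OF sol])
  have cw: "continuous_on UNIV w"
    unfolding w_def by (intro continuous_intros continuous_antideriv continuous_integrable g)
  have "v 1 - w 1 \<le> v 0 - w 0"
  proof (rule viscosity_nonincreasing[where f = "\<lambda>x. v x - w x"])
    show "continuous_on UNIV (\<lambda>x. v x - w x)"
      by (intro continuous_on_diff C_torus_continuous[OF vT] cw)
    fix \<phi> \<phi>' x
    assume \<phi>: "C1_with_deriv \<phi> \<phi>'" and t: "\<forall>\<^sub>F y in nhds x. v y - w y - \<phi> y \<le> v x - w x - \<phi> x"
    have C1: "C1_with_deriv (\<lambda>y. \<phi> y + w y) (\<lambda>y. \<phi>' y + (g y - p))"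
      using \<phi> w unfolding C1_with_deriv_def by (auto intro: DERIV_add continuous_on_add)
    have "\<forall>\<^sub>F y in nhds x. v y - (\<phi> y + w y) \<le> v x - (\<phi> x + w x)"
      by (rule eventually_mono[OF t]) simp
    then have "H (p + (\<phi>' x + (g x - p))) + V x - c \<le> 0"
      by (rule viscosity_subsolutionD[OF cell_solutionD(2)[OF sol] C1])
    then have "\<phi>' x + g x \<le> up (c - V x)" by (intro le_up) (simp add: algebra_simps)
    then show "\<phi>' x \<le> 0" using f(2)[of "c - V x"] by (simp add: g_def)
  qed simp
  then have "p \<le> antideriv g 1" using C_torus_periodic[OF vT, of 0] by (simp add: w_def)
  then show ?thesis by (simp add: antideriv_def g_def)
qed

lemma cell_mean_ge:
  assumes V: "V \<in> C_torus" and sol: "cell_solution H V p c v"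
    and f: "continuous_on UNIV f" "\<And>s. f s \<le> lo s"
  shows "integral {0..1} (\<lambda>x. f (c - V x)) \<le> p"
proof -
  have "(\<lambda>x. V (- x)) \<in> C_torus" by (rule C_torus_reflect[OF V])
  moreover have "cell_solution (\<lambda>q. H (- q)) (\<lambda>x. V (- x)) (- p) c (\<lambda>x. v (- x))"
    by (rule cell_solution_reflect) (use sol in simp)
  moreover have "upper_root (\<lambda>q. H (- q)) (- q0) s \<le> - f s" for s
    using f(2)[of s] by (simp add: lower_root_def)
  ultimately have "- p \<le> integral {0..1} (\<lambda>x. - f (c - V (- x)))"
    using qc_hamiltonian.cell_mean_le[OF reflect _ _ continuous_on_minus[OF f(1)]] by blast
  moreover have "integral {0..1} (\<lambda>x. f (c - V (- x))) = integral {0..1} (\<lambda>x. f (c - V x))"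
    by (rule integral_periodic_reflect[of "\<lambda>x. f (c - V x)"]) (simp add: C_torus_periodic[OF V])
  ultimately show ?thesis by simp
qed

text \<open>The assumptions on means involve continuous majorants and minorants of the roots only,
  so that they carry over between equally distributed potentials.\<close>

lemma cell_constant_le_if_means:
  assumes V: "V \<in> C_torus" and sol: "cell_solution H V p c' v"
    and c: "\<And>x. H q0 + V x \<le> c"
    and mu: "\<And>f. continuous_on UNIV f \<Longrightarrow> (\<And>s. up s \<le> f s) \<Longrightarrow> p \<le> integral {0..1} (\<lambda>x. f (c - V x))"
    and ml: "\<And>f. continuous_on UNIV f \<Longrightarrow> (\<And>s. f s \<le> lo s) \<Longrightarrow> integral {0..1} (\<lambda>x. f (c - V x)) \<le> p"
  shows "c' \<le> c"
proof (rule field_le_epsilon)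
  fix e :: real assume e: "0 < e"
  obtain fu where fu: "continuous_on UNIV fu" "\<And>s. up s \<le> fu s" "\<And>s. fu s \<le> up (s + e)"
    using up_smooth[OF e] by blast
  obtain fl where fl: "continuous_on UNIV fl" "\<And>s. fl s \<le> lo s" "\<And>s. lo (s + e) \<le> fl s"
    using lo_smooth[OF e] by blast
  define gu gl where "gu = (\<lambda>x. fu (c - V x))" and "gl = (\<lambda>x. fl (c - V x))"
  have cg: "continuous_on UNIV gu" "continuous_on UNIV gl"
    unfolding gu_def gl_def using continuous_compose_torus[OF V] fu fl by auto
  have p: "integral {0..1} gl \<le> p" "p \<le> integral {0..1} gu"
    unfolding gu_def gl_def using mu[OF fu(1,2)] ml[OF fl(1,2)] by auto
  \<comment> \<open>Some convex combination of the two smoothed branches has mean exactly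
    \<open>p\<close>. It remains between \<open>lo\<close> and \<open>up\<close> at the level raised
    by \<open>e\<close>, hence in the sublevel set.\<close>
  then have "p \<in> closed_segment (integral {0..1} gl) (integral {0..1} gu)"
    by (simp add: closed_segment_eq_real_ivl)
  then obtain \<theta> where \<theta>: "0 \<le> \<theta>" "\<theta> \<le> 1"
    "p = (1 - \<theta>) * integral {0..1} gl + \<theta> * integral {0..1} gu"
    by (auto simp: in_segment)
  define g where "g = (\<lambda>x. (1 - \<theta>) * gl x + \<theta> * gu x)"
  show "c' \<le> c + e"
  proof (rule cell_constant_le_if_C1_subsolution[OF sol])
    show "continuous_on UNIV g" unfolding g_def by (intro continuous_intros cg)
    show "g (x + 1) = g x" for x by (simp add: g_def gl_def gu_def C_torus_periodic[OF V])
    show "integral {0..1} g = p"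
      unfolding g_def \<theta>(3)
      by (subst Henstock_Kurzweil_Integration.integral_add)
         (auto intro!: continuous_integrable continuous_intros cg)
    show "H (g x) + V x \<le> c + e" for x
    proof -
      have b: "lo (c - V x + e) \<le> gl x" "gl x \<le> gu x" "gu x \<le> up (c - V x + e)"
        unfolding gl_def gu_def
        using fl(2,3)[of "c - V x"] fu(2,3)[of "c - V x"] lo_le_q0[of "c - V x"] q0_le_up[of "c - V x"]
        by linarith+
      have "gl x \<le> g x" "g x \<le> gu x"
      proof -
        have *: "g x = gl x + \<theta> * (gu x - gl x)" "g x = gu x - (1 - \<theta>) * (gu x - gl x)"
          by (simp_all add: g_def algebra_simps)
        show "gl x \<le> g x" unfolding *(1) using \<theta> b by simp
        show "g x \<le> gu x" unfolding *(2) using \<theta> b by simp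
      qed
      then have "H (g x) \<le> c - V x + e"
        using b c[of x] e by - (rule H_between; linarith)
      then show ?thesis by simp
    qed
  qed
qed

text \<open>Taking \<open>V1 = V2\<close> also yields uniqueness of the constant.\<close>

lemma same_distribution_cell_constant_le:
  assumes V: "V1 \<in> C_torus" "V2 \<in> C_torus" and dist: "same_distribution V1 V2"
    and sol: "cell_solution H V1 p c1 v1" "cell_solution H V2 p c2 v2"
  shows "c2 \<le> c1"
proof (rule cell_constant_le_if_means[OF V(2) sol(2)])
  have "V1 x \<le> c1 - H q0" for x using cell_constant_ge[OF V(1) sol(1), of x] by simp
  then show "H q0 + V2 x \<le> c1" for x
    using same_distribution_upper_bound[OF V dist, of "c1 - H q0" x] by simp
  have eq: "integral {0..1} (\<lambda>x. f (c1 - V1 x)) = integral {0..1} (\<lambda>x. f (c1 - V2 x))"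
    if "continuous_on UNIV f" for f :: "real \<Rightarrow> real"
  proof -
    have "continuous_on UNIV (\<lambda>t. f (c1 - t))"
      by (intro continuous_on_compose2[OF that] continuous_intros) auto
    then show ?thesis by (rule same_distributionD[OF dist, where f = "\<lambda>t. f (c1 - t)"])
  qed
  show "p \<le> integral {0..1} (\<lambda>x. f (c1 - V2 x))" if "continuous_on UNIV f" "\<And>s. up s \<le> f s" for f
    using cell_mean_le[OF V(1) sol(1) that] eq[OF that(1)] by simp
  show "integral {0..1} (\<lambda>x. f (c1 - V2 x)) \<le> p" if "continuous_on UNIV f" "\<And>s. f s \<le> lo s" for f
    using cell_mean_ge[OF V(1) sol(1) that] eq[OF that(1)] by simp
qed

section \<open>Existence of solutions of the cell problem\<close>

lemma mono_lo: "mono (\<lambda>s. - lo s)"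
  using qc_hamiltonian.mono_up[OF reflect] by (simp add: lower_root_def mono_def)

lemma lo_integrable:
  assumes "V \<in> C_torus"
  shows "(\<lambda>x. lo (c - V x)) integrable_on {a..b}"
  using integrable_neg[OF compose_torus_integrable[OF assms mono_lo]] by simp

text \<open>If \<open>up s < a\<close>, then \<open>s < H a\<close>, and \<open>a\<close> stays
  outside the sublevel sets of slightly higher levels. As \<open>q0 \<le> a\<close>, these sets
  cannot reach beyond \<open>a\<close> without containing it.\<close>

lemma up_right_continuous:
  "(\<lambda>n. up (s + 1 / real (Suc n))) \<longlonglongrightarrow> up s"
proof (rule order_tendstoI)
  fix a assume "a < up s"
  then show "\<forall>\<^sub>F n in sequentially. a < up (s + 1 / real (Suc n))"
    using monoD[OF mono_up, of s "s + 1 / real (Suc n)" for n]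
    by (intro always_eventually) (auto intro: less_le_trans)
next
  fix a assume a: "up s < a"
  have "s < H a" using le_up[of a s] a by linarith
  moreover have "(\<lambda>n. s + 1 / real (Suc n)) \<longlonglongrightarrow> s + 0"
    by (intro tendsto_add tendsto_const LIMSEQ_Suc[OF lim_1_over_n])
  ultimately have "\<forall>\<^sub>F n in sequentially. s + 1 / real (Suc n) < H a"
    by (simp add: order_tendstoD(2))
  then show "\<forall>\<^sub>F n in sequentially. up (s + 1 / real (Suc n)) < a"
  proof (rule eventually_mono)
    fix n assume n: "s + 1 / real (Suc n) < H a"
    show "up (s + 1 / real (Suc n)) < a"
    proof (rule ccontr)
      assume neg: "\<not> up (s + 1 / real (Suc n)) < a"
      have "q0 \<le> a" using q0_le_up[of s] a by simp
      show False
      proof (cases "H q0 \<le> s + 1 / real (Suc n)")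
        case True
        then show ?thesis using H_between_q0_up[OF True \<open>q0 \<le> a\<close>] neg n by simp
      next
        \<comment> \<open>Below the minimum of \<open>H\<close> the sublevel set is empty and the
          root takes its default value \<open>q0\<close>.\<close>
        case False
        then have "{q. H q \<le> s + 1 / real (Suc n)} = {}"
          using min order_trans by blast
        then show ?thesis using neg a q0_le_up[of s] by (simp add: upper_root_def)
      qed
    qed
  qed
qed

lemma up_left_limit:
  "(\<lambda>n. up (s - 1 / real (Suc n))) \<longlonglongrightarrow> left s"
proof (rule order_tendstoI)
  fix a assume a: "left s < a"
  show "\<forall>\<^sub>F n in sequentially. up (s - 1 / real (Suc n)) < a"
    using up_le_left[of "s - 1 / real (Suc n)" s for n] a
    by (intro always_eventually) (auto intro: le_less_trans)
next
  fix a assume "a < left s"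
  then obtain q where q: "q \<in> insert q0 {q. H q < s}" "a < q"
    unfolding strict_upper_root_def using less_cSup_iff[OF _ bdd_above_sublevels(2)] by blast
  show "\<forall>\<^sub>F n in sequentially. a < up (s - 1 / real (Suc n))"
  proof (cases "q = q0")
    case True
    then show ?thesis
      using q(2) by (intro always_eventually) (auto intro: less_le_trans q0_le_up)
  next
    case False
    then have "H q < s" using q(1) by simp
    moreover have "(\<lambda>n. s - 1 / real (Suc n)) \<longlonglongrightarrow> s - 0"
      by (intro tendsto_diff tendsto_const LIMSEQ_Suc[OF lim_1_over_n])
    ultimately have "\<forall>\<^sub>F n in sequentially. H q < s - 1 / real (Suc n)"
      by (simp add: order_tendstoD(1))
    then show ?thesis
      by (rule eventually_mono) (use q(2) le_up[of q] in \<open>meson less_imp_le less_le_trans\<close>)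
  qed
qed

lemma up_mean_right_continuous:
  assumes V: "V \<in> C_torus"
  shows "(\<lambda>n. integral {0..1} (\<lambda>x. up (c + 1 / real (Suc n) - V x))) \<longlonglongrightarrow> integral {0..1} (\<lambda>x. up (c - V x))"
proof -
  obtain K where K: "\<And>x c'. \<bar>c' - c\<bar> \<le> 1 \<Longrightarrow> \<bar>up (c' - V x)\<bar> \<le> K"
    using compose_torus_bounded[OF V mono_up] by blast
  show ?thesis
  proof (rule dominated_convergence(2)[where h = "\<lambda>_. K"])
    show "(\<lambda>x. up (c + 1 / real (Suc n) - V x)) integrable_on {0..1}" for n
      by (rule compose_torus_integrable[OF V mono_up])
    show "norm (up (c + 1 / real (Suc n) - V x)) \<le> K" for n x
      using K[of "c + 1 / real (Suc n)" x] inverse_Suc_le_1[of n] by simp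
    show "(\<lambda>n. up (c + 1 / real (Suc n) - V x)) \<longlonglongrightarrow> up (c - V x)" for x
      using up_right_continuous[of "c - V x"] by (simp add: algebra_simps)
  qed auto
qed

lemma up_mean_left_limit:
  assumes V: "V \<in> C_torus"
  shows "(\<lambda>n. integral {0..1} (\<lambda>x. up (c - 1 / real (Suc n) - V x))) \<longlonglongrightarrow> integral {0..1} (\<lambda>x. left (c - V x))"
proof -
  obtain K where K: "\<And>x c'. \<bar>c' - c\<bar> \<le> 1 \<Longrightarrow> \<bar>up (c' - V x)\<bar> \<le> K"
    using compose_torus_bounded[OF V mono_up] by blast
  show ?thesis
  proof (rule dominated_convergence(2)[where h = "\<lambda>_. K"])
    show "(\<lambda>x. up (c - 1 / real (Suc n) - V x)) integrable_on {0..1}" for n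
      by (rule compose_torus_integrable[OF V mono_up])
    show "norm (up (c - 1 / real (Suc n) - V x)) \<le> K" for n x
      using K[of "c - 1 / real (Suc n)" x] inverse_Suc_le_1[of n] by simp
    show "(\<lambda>n. up (c - 1 / real (Suc n) - V x)) \<longlonglongrightarrow> left (c - V x)" for x
      using up_left_limit[of "c - V x"] by (simp add: algebra_simps)
  qed auto
qed

text \<open>A slope between \<open>left (c - V)\<close> and \<open>up (c - V)\<close> lies in the
  sublevel set, and above every \<open>q\<close> with \<open>H q < c - V\<close>. So the left-sided
  alternative of \<open>cell_solution_of_slope\<close> holds at every point. The freedom between the
  two roots is used to adjust the mean to \<open>p\<close>.\<close>

lemma cell_solution_mixture:
  assumes V: "V \<in> C_torus" and c: "\<And>x. H q0 + V x \<le> c"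
    and p: "integral {0..1} (\<lambda>x. left (c - V x)) \<le> p" "p \<le> integral {0..1} (\<lambda>x. up (c - V x))"
  shows "\<exists>v. cell_solution H V p c v"
proof -
  define gl gu where "gl = (\<lambda>x. left (c - V x))" and "gu = (\<lambda>x. up (c - V x))"
  have int: "gl integrable_on {a..b}" "gu integrable_on {a..b}" for a b
    unfolding gl_def gu_def by (rule compose_torus_integrable[OF V mono_left] compose_torus_integrable[OF V mono_up])+
  have "p \<in> closed_segment (integral {0..1} gl) (integral {0..1} gu)"
    using p by (simp add: closed_segment_eq_real_ivl gl_def gu_def)
  then obtain \<theta> where \<theta>: "0 \<le> \<theta>" "\<theta> \<le> 1"
    "p = (1 - \<theta>) * integral {0..1} gl + \<theta> * integral {0..1} gu"
    by (auto simp: in_segment)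
  define g where "g = (\<lambda>x. (1 - \<theta>) * gl x + \<theta> * gu x)"
  have between: "gl x \<le> g x" "g x \<le> gu x" for x
  proof -
    have *: "g x = gl x + \<theta> * (gu x - gl x)" "g x = gu x - (1 - \<theta>) * (gu x - gl x)"
      by (simp_all add: g_def algebra_simps)
    have le: "gl x \<le> gu x" unfolding gl_def gu_def by (rule left_le_up)
    show "gl x \<le> g x" unfolding *(1) using \<theta> le by simp
    show "g x \<le> gu x" unfolding *(2) using \<theta> le by simp
  qed
  have "cell_solution H V p c (\<lambda>x. antideriv g x - p * x)"
  proof (rule cell_solution_of_slope[OF cont qc V])
    show "g integrable_on {a..b}" for a b
      unfolding g_def by (intro integrable_add integrable_on_mult_right int)
    show "g (x + 1) = g x" for x by (simp add: g_def gl_def gu_def C_torus_periodic[OF V])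
    show "integral {0..1} g = p"
      unfolding g_def \<theta>(3)
      by (subst Henstock_Kurzweil_Integration.integral_add) (auto intro!: integrable_on_mult_right int)
    show "H (g x) \<le> c - V x" for x
    proof (rule H_between_q0_up)
      show "H q0 \<le> c - V x" using c[of x] by simp
      show "q0 \<le> g x" using between(1)[of x] q0_le_left[of "c - V x"] by (simp add: gl_def)
      show "g x \<le> up (c - V x)" using between(2)[of x] by (simp add: gu_def)
    qed
    have "q \<le> g x" if "H q < c - V x" for q x
      using le_left[OF that] between(1)[of x] by (simp add: gl_def)
    then show "(\<forall>q. c - V y \<le> H q) \<or>
       (\<forall>\<^sub>F x in at_left y. \<forall>q. H q < c - V x \<longrightarrow> q \<le> g x) \<or>
       (\<forall>\<^sub>F x in at_right y. \<forall>q. H q < c - V x \<longrightarrow> g x \<le> q)" for y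
      by (intro disjI2 disjI1 always_eventually) blast
  qed
  then show ?thesis by blast
qed

text \<open>The mean of \<open>up (c - V)\<close> increases with \<open>c\<close> but may jump over
  \<open>p\<close>. At the least level where it reaches \<open>p\<close>, right continuity gives the
  upper bound and the left limit the lower bound required by
  \<open>cell_solution_mixture\<close>.\<close>

lemma cell_solution_upper:
  assumes V: "V \<in> C_torus" and x0: "\<And>x. V x \<le> V x0"
    and p: "integral {0..1} (\<lambda>x. up (H q0 + V x0 - V x)) < p"
  shows "\<exists>c v. cell_solution H V p c v"
proof -
  define c0 where "c0 = H q0 + V x0"
  define I where "I = (\<lambda>c. integral {0..1} (\<lambda>x. up (c - V x)))"
  define S where "S = {c. c0 \<le> c \<and> p \<le> I c}"
  have int: "(\<lambda>x. up (c - V x)) integrable_on {0..1}" for c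
    by (rule compose_torus_integrable[OF V mono_up])
  have mono_I: "I c \<le> I c'" if "c \<le> c'" for c c'
    unfolding I_def by (rule integral_le[OF int int]) (use that in \<open>auto intro: monoD[OF mono_up]\<close>)
  \<comment> \<open>At the level \<open>H p + V x0\<close> the number \<open>p\<close> belongs to
    the sublevel set for every \<open>x\<close>, so the mean of the upper roots is at least
    \<open>p\<close>.\<close>
  define C where "C = max c0 (H p + V x0)"
  have "p \<le> I C"
  proof -
    have "p * (1 - 0) \<le> I C"
      unfolding I_def
    proof (rule integral_ge_open[OF int])
      fix x :: real
      show "p \<le> up (C - V x)" using x0[of x] by (intro le_up) (simp add: C_def)
    qed simp
    then show ?thesis by simp
  qed
  then have "C \<in> S" by (simp add: S_def, simp add: C_def)
  then have S: "S \<noteq> {}" by blast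
  have bddS: "bdd_below S" by (rule bdd_belowI[of _ c0]) (simp add: S_def)
  define c where "c = Inf S"
  have c0c: "c0 \<le> c" unfolding c_def by (rule cInf_greatest[OF S]) (simp add: S_def)
  have up_p: "p \<le> I c"
  proof (rule LIMSEQ_le_const)
    show "(\<lambda>n. I (c + 1 / real (Suc n))) \<longlonglongrightarrow> I c"
      unfolding I_def by (rule up_mean_right_continuous[OF V])
    have "p \<le> I (c + 1 / real (Suc n))" for n
    proof -
      have "Inf S < c + 1 / real (Suc n)" by (simp add: c_def)
      then obtain c' where "c' \<in> S" "c' < c + 1 / real (Suc n)"
        using cInf_lessD[OF S] by blast
      then show ?thesis using mono_I[of c' "c + 1 / real (Suc n)"] by (simp add: S_def)
    qed
    then show "\<exists>N. \<forall>n\<ge>N. p \<le> I (c + 1 / real (Suc n))" by blast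
  qed
  have "c0 \<noteq> c" using up_p p by (auto simp: I_def c0_def)
  \<comment> \<open>Strictness ensures that levels slightly below \<open>c\<close> still exceed
    \<open>c0\<close>. They are outside \<open>S\<close> only because their mean is less than
    \<open>p\<close>.\<close>
  then have lt: "c0 < c" using c0c by simp
  have left_p: "integral {0..1} (\<lambda>x. left (c - V x)) \<le> p"
  proof (rule LIMSEQ_le_const2)
    show "(\<lambda>n. I (c - 1 / real (Suc n))) \<longlonglongrightarrow> integral {0..1} (\<lambda>x. left (c - V x))"
      unfolding I_def by (rule up_mean_left_limit[OF V])
    have "(\<lambda>n. c - 1 / real (Suc n)) \<longlonglongrightarrow> c - 0"
      by (intro tendsto_diff tendsto_const LIMSEQ_Suc[OF lim_1_over_n])
    then have "\<forall>\<^sub>F n in sequentially. c0 < c - 1 / real (Suc n)"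
      using lt by (simp add: order_tendstoD(1))
    then obtain N where N: "\<And>n. n \<ge> N \<Longrightarrow> c0 < c - 1 / real (Suc n)"
      unfolding eventually_sequentially by blast
    have "I (c - 1 / real (Suc n)) \<le> p" if "n \<ge> N" for n
    proof (rule ccontr)
      assume "\<not> ?thesis"
      then have "c - 1 / real (Suc n) \<in> S" using N[OF that] by (simp add: S_def)
      then have "c \<le> c - 1 / real (Suc n)" unfolding c_def by (rule cInf_lower[OF _ bddS])
      then show False using inverse_Suc_le_1(2)[of n] by linarith
    qed
    then show "\<exists>N. \<forall>n\<ge>N. I (c - 1 / real (Suc n)) \<le> p" by blast
  qed
  have "H q0 + V x \<le> c" for x using x0[of x] c0c by (simp add: c0_def)
  then show ?thesis using cell_solution_mixture[OF V _ left_p] up_p unfolding I_def by blast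
qed

text \<open>Passing from the upper to the lower branch makes a downward kink, which is harmless. The
  return to the upper branch is placed at \<open>x0\<close>, where \<open>c0 - V x0\<close> is the
  minimum of \<open>H\<close> and the supersolution inequality is trivial.\<close>

lemma cell_solution_switch:
  assumes V: "V \<in> C_torus" and x0: "\<And>x. V x \<le> V x0"
    and c0: "c0 = H q0 + V x0"
    and p: "integral {0..1} (\<lambda>x. lo (c0 - V x)) \<le> p" "p \<le> integral {0..1} (\<lambda>x. up (c0 - V x))"
  shows "\<exists>v. cell_solution H V p c0 v"
proof -
  define gl gu where "gl = (\<lambda>x. lo (c0 - V x))" and "gu = (\<lambda>x. up (c0 - V x))"
  have int: "gl integrable_on {a..b}" "gu integrable_on {a..b}" for a b
    unfolding gl_def gu_def by (rule lo_integrable[OF V] compose_torus_integrable[OF V mono_up])+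
  have per: "gl (x + 1) = gl x" "gu (x + 1) = gu x" for x
    by (simp_all add: gl_def gu_def C_torus_periodic[OF V])
  \<comment> \<open>\<open>G t\<close> is the integral over \<open>[x0, x0 + 1]\<close> of the slope
    that follows \<open>gu\<close> for a length \<open>t\<close> and \<open>gl\<close> afterwards.
    The intermediate value theorem picks the switching point with mean \<open>p\<close>.\<close>
  define G where "G = (\<lambda>t. (antideriv gu (x0 + t) - antideriv gu x0) + (antideriv gl (x0 + 1) - antideriv gl (x0 + t)))"
  have "continuous_on UNIV (\<lambda>t. antideriv gu (x0 + t))" "continuous_on UNIV (\<lambda>t. antideriv gl (x0 + t))"
    by (rule continuous_on_compose2[OF continuous_antideriv[OF int(2)]]
             continuous_on_compose2[OF continuous_antideriv[OF int(1)]];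
        auto intro: continuous_intros)+
  then have "continuous_on UNIV G"
    unfolding G_def by (intro continuous_on_add continuous_on_diff continuous_on_const)
  then have "continuous_on {0..1} G" using continuous_on_subset by blast
  moreover have "G 0 \<le> p"
    using antideriv_diff[OF int(1), of x0 "x0+1"] integral_period[OF int(1) per(1), of x0] p(1)
    by (simp add: G_def gl_def)
  moreover have "p \<le> G 1"
    using antideriv_diff[OF int(2), of x0 "x0+1"] integral_period[OF int(2) per(2), of x0] p(2)
    by (simp add: G_def gu_def)
  ultimately obtain t where t: "0 \<le> t" "t \<le> 1" "G t = p"
    using IVT'[of G 0 p 1] by auto
  define g where "g = (\<lambda>x. if frac (x - x0) < t then gu x else gl x)"
  have g_per: "g (x + 1) = g x" for x
    using frac_1_eq[of "x - x0"] by (simp add: g_def per diff_add_eq)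
  have g_int: "g integrable_on {a..b}" for a b
  proof -
    obtain K1 where K1: "\<And>x c'. \<bar>c' - c0\<bar> \<le> 1 \<Longrightarrow> \<bar>up (c' - V x)\<bar> \<le> K1"
      using compose_torus_bounded[OF V mono_up] by blast
    obtain K2 where K2: "\<And>x c'. \<bar>c' - c0\<bar> \<le> 1 \<Longrightarrow> \<bar>- lo (c' - V x)\<bar> \<le> K2"
      using compose_torus_bounded[OF V mono_lo] by blast
    show ?thesis
    proof (rule bounded_borel_integrable)
      have [measurable]: "gu \<in> borel_measurable borel"
        unfolding gu_def by (rule compose_torus_borel[OF V mono_up])
      have "(\<lambda>x. - (- gl x)) \<in> borel_measurable borel"
        unfolding gl_def by (intro borel_measurable_uminus compose_torus_borel[OF V mono_lo])
      then have [measurable]: "gl \<in> borel_measurable borel" by simp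
      show "g \<in> borel_measurable borel"
        unfolding g_def frac_def by measurable
      show "\<bar>g x\<bar> \<le> max K1 K2" for x
        using K1[of c0 x] K2[of c0 x] by (auto simp: g_def gu_def gl_def)
    qed
  qed
  have "integral {x0..x0+t} g = integral {x0..x0+t} gu"
    unfolding integral_open_interval_real
  proof (rule Henstock_Kurzweil_Integration.integral_cong)
    fix x assume "x \<in> {x0<..<x0+t}"
    then have "frac (x - x0) = x - x0" "x - x0 < t" using t by (auto simp: frac_eq)
    then show "g x = gu x" by (simp add: g_def)
  qed
  moreover have "integral {x0+t..x0+1} g = integral {x0+t..x0+1} gl"
    unfolding integral_open_interval_real
  proof (rule Henstock_Kurzweil_Integration.integral_cong)
    fix x assume "x \<in> {x0+t<..<x0+1}"
    then have "frac (x - x0) = x - x0" "\<not> x - x0 < t" using t by (auto simp: frac_eq)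
    then show "g x = gl x" by (simp add: g_def)
  qed
  moreover have "integral {x0..x0+t} g + integral {x0+t..x0+1} g = integral {x0..x0+1} g"
    using t by (intro Henstock_Kurzweil_Integration.integral_combine g_int) auto
  moreover have "integral {x0..x0+t} gu + integral {x0+t..x0+1} gl = G t"
    using antideriv_diff[OF int(2), of x0 "x0+t"] antideriv_diff[OF int(1), of "x0+t" "x0+1"] t
    by (simp add: G_def)
  ultimately have g_p: "integral {0..1} g = p"
    using integral_period[OF g_int g_per, of x0] t(3) by simp
  have "cell_solution H V p c0 (\<lambda>x. antideriv g x - p * x)"
  proof (rule cell_solution_of_slope[OF cont qc V g_int g_per g_p])
    show "H (g x) \<le> c0 - V x" for x
    proof (rule H_between)
      show "H q0 \<le> c0 - V x" using x0[of x] by (simp add: c0)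
      show "lo (c0 - V x) \<le> g x" "g x \<le> up (c0 - V x)"
        using lo_le_q0[of "c0 - V x"] q0_le_up[of "c0 - V x"] by (auto simp: g_def gl_def gu_def)
    qed
    show "(\<forall>q. c0 - V y \<le> H q) \<or>
       (\<forall>\<^sub>F x in at_left y. \<forall>q. H q < c0 - V x \<longrightarrow> q \<le> g x) \<or>
       (\<forall>\<^sub>F x in at_right y. \<forall>q. H q < c0 - V x \<longrightarrow> g x \<le> q)" for y
    proof -
      define r where "r = frac (y - x0)"
      define n where "n = \<lfloor>y - x0\<rfloor>"
      have y: "y = x0 + of_int n + r" by (simp add: r_def n_def frac_def)
      have r: "0 \<le> r" "r < 1" by (simp_all add: r_def frac_lt_1)
      have fr: "frac (x - x0) = x - x0 - of_int n" if "x0 + of_int n \<le> x" "x < x0 + of_int n + 1" for x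
        using that by (simp add: frac_unique_iff)
      \<comment> \<open>These are the translates of \<open>x0\<close>, the points with the upper
        branch on their left, and those with the lower branch on their right. The switching point
        \<open>r = t\<close> fits the second case because only its left neighbours are
        inspected.\<close>
      consider "r = 0" | "0 < r" "r \<le> t" | "0 < r" "t < r" using r by linarith
      then show ?thesis
      proof cases
        case 1
        then have "V y = V x0"
          using y periodic_int[of V x0 n, OF C_torus_periodic[OF V]] by simp
        then show ?thesis using min by (simp add: c0)
      next
        case 2
        have "\<forall>\<^sub>F x in at_left y. x \<in> {y-r<..<y}"
          using 2 by (intro eventually_at_leftI[of "y-r"]) auto
        then have "\<forall>\<^sub>F x in at_left y. \<forall>q. H q < c0 - V x \<longrightarrow> q \<le> g x"
        proof (rule eventually_mono)
          fix x assume "x \<in> {y-r<..<y}"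
          then have "frac (x - x0) < t" using fr[of x] y r 2 by simp
          then show "\<forall>q. H q < c0 - V x \<longrightarrow> q \<le> g x"
            using le_up[of _ "c0 - V x"] by (simp add: g_def gu_def)
        qed
        then show ?thesis by blast
      next
        case 3
        have "\<forall>\<^sub>F x in at_right y. x \<in> {y<..<y+(1-r)}"
          using r by (intro eventually_at_rightI[of y "y+(1-r)"]) auto
        then have "\<forall>\<^sub>F x in at_right y. \<forall>q. H q < c0 - V x \<longrightarrow> g x \<le> q"
        proof (rule eventually_mono)
          fix x assume "x \<in> {y<..<y+(1-r)}"
          then have "\<not> frac (x - x0) < t" using fr[of x] y r 3 by simp
          then show "\<forall>q. H q < c0 - V x \<longrightarrow> g x \<le> q"
            using lo_le[of _ "c0 - V x"] by (simp add: g_def gl_def)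
        qed
        then show ?thesis by blast
      qed
    qed
  qed
  then show ?thesis by blast
qed

lemma cell_solution_exists:
  assumes V: "V \<in> C_torus"
  shows "\<exists>c v. cell_solution H V p c v"
proof -
  obtain x0 where x0: "\<And>x. V x \<le> V x0" using C_torus_attains_max[OF V] by blast
  define c0 where "c0 = H q0 + V x0"
  consider "integral {0..1} (\<lambda>x. up (c0 - V x)) < p"
    | "integral {0..1} (\<lambda>x. lo (c0 - V x)) \<le> p" "p \<le> integral {0..1} (\<lambda>x. up (c0 - V x))"
    | "p < integral {0..1} (\<lambda>x. lo (c0 - V x))"
    by linarith
  then show ?thesis
  proof cases
    case 1
    then show ?thesis using cell_solution_upper[OF V x0] by (simp add: c0_def)
  next
    case 2
    then show ?thesis using cell_solution_switch[OF V x0 c0_def] by blast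
  next
    case 3
    have "\<exists>c v. cell_solution (\<lambda>q. H (- q)) (\<lambda>x. V (- x)) (- p) c v"
    proof (rule qc_hamiltonian.cell_solution_upper[OF reflect C_torus_reflect[OF V], of "- x0"])
      show "V (- x) \<le> V (- (- x0))" for x using x0 by simp
      have "integral {0..1} (\<lambda>x. lo (c0 - V (- x))) = integral {0..1} (\<lambda>x. lo (c0 - V x))"
        by (rule integral_periodic_reflect[of "\<lambda>x. lo (c0 - V x)"]) (simp add: C_torus_periodic[OF V])
      then have "integral {0..1} (\<lambda>x. - lo (c0 - V (- x))) < - p" using 3 by simp
      then show "integral {0..1} (\<lambda>x. upper_root (\<lambda>q. H (- q)) (- q0) (H (- (- q0)) + V (- (- x0)) - V (- x))) < - p"
        by (simp add: lower_root_def c0_def)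
    qed
    then show ?thesis using cell_solution_reflect by blast
  qed
qed

lemma effective_hamiltonian_cong_distribution:
  assumes V: "V1 \<in> C_torus" "V2 \<in> C_torus" and dist: "same_distribution V1 V2"
  shows "effective_hamiltonian H V1 = effective_hamiltonian H V2"
proof
  fix p
  have sym: "same_distribution V2 V1" and refl: "same_distribution V1 V1" "same_distribution V2 V2"
    using dist by (simp_all add: same_distribution_def)
  obtain c1 v1 where 1: "cell_solution H V1 p c1 v1" using cell_solution_exists[OF V(1)] by blast
  obtain c2 v2 where 2: "cell_solution H V2 p c2 v2" using cell_solution_exists[OF V(2)] by blast
  have "effective_hamiltonian H V1 p = c1"
    unfolding effective_hamiltonian_def
    using 1 same_distribution_cell_constant_le[OF V(1) V(1) refl(1)]
    by (intro the_equality) (blast, metis antisym)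
  moreover have "effective_hamiltonian H V2 p = c2"
    unfolding effective_hamiltonian_def
    using 2 same_distribution_cell_constant_le[OF V(2) V(2) refl(2)]
    by (intro the_equality) (blast, metis antisym)
  moreover have "c1 = c2"
    using same_distribution_cell_constant_le[OF V dist 1 2]
      same_distribution_cell_constant_le[OF V(2,1) sym 2 1] by simp
  ultimately show "effective_hamiltonian H V1 p = effective_hamiltonian H V2 p" by simp
qed

end

section \<open>Strongly superlinear Hamiltonians\<close>

lemma derivative_eq_if_touching:
  assumes "(f has_real_derivative f') (at x)" "(g has_real_derivative g') (at x)"
    and "\<forall>\<^sub>F y in nhds x. f y - g y \<le> f x - g x"
  shows "f' = (g'::real)"
proof -
  obtain d where d: "0 < d" "\<And>y. dist y x < d \<Longrightarrow> f y - g y \<le> f x - g x"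
    using assms(3) unfolding eventually_nhds_metric by blast
  have "((\<lambda>y. f y - g y) has_real_derivative f' - g') (at x)"
    by (intro DERIV_diff assms)
  then have "f' - g' = 0"
    by (rule DERIV_local_max[OF _ d(1)]) (use d(2) in \<open>auto simp: dist_real_def abs_minus_commute\<close>)
  then show ?thesis by simp
qed

text \<open>A differentiable solution admits only test functions with its own slope. Being both a
  sub- and a supersolution of class C1, it also fixes the constant of any other solution, so this
  works for Hamiltonians that are not quasi-convex.\<close>

lemma effective_hamiltonian_eq_if_C1_solution:
  assumes g: "continuous_on UNIV g" "\<And>x. g (x + 1) = g x" "integral {0..1} g = p"
    and eq: "\<And>x. H (g x) + V x = c"
  shows "effective_hamiltonian H V p = c"
proof -
  define w where "w = (\<lambda>x. antideriv g x - p * x)"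
  have wT: "w \<in> C_torus" unfolding w_def by (rule corrector_torus[OF continuous_integrable[OF g(1)] g(2,3)])
  have "C1_with_deriv w (\<lambda>x. g x - p)" unfolding w_def by (rule corrector_C1[OF g(1)])
  then have D: "(w has_real_derivative g x - p) (at x)" for x by (simp add: C1_with_deriv_def)
  have "cell_solution H V p c w"
  proof (rule cell_solutionI[OF wT])
    fix \<phi> \<phi>' y assume "C1_with_deriv \<phi> \<phi>'"
    then have D': "(\<phi> has_real_derivative \<phi>' y) (at y)" by (simp add: C1_with_deriv_def)
    show "H (p + \<phi>' y) + V y - c \<le> 0" if "\<forall>\<^sub>F x in nhds y. w x - \<phi> x \<le> w y - \<phi> y"
    proof -
      have "p + \<phi>' y = g y" using derivative_eq_if_touching[OF D D' that] by simp
      then show ?thesis using eq[of y] by simp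
    qed
    show "H (p + \<phi>' y) + V y - c \<ge> 0" if "\<forall>\<^sub>F x in nhds y. w x - \<phi> x \<ge> w y - \<phi> y"
    proof -
      have "\<forall>\<^sub>F x in nhds y. \<phi> x - w x \<le> \<phi> y - w y" by (rule eventually_mono[OF that]) simp
      then have "p + \<phi>' y = g y" using derivative_eq_if_touching[OF D' D] by fastforce
      then show ?thesis using eq[of y] by simp
    qed
  qed
  moreover have "c' = c" if "cell_solution H V p c' v" for c' v
    using cell_constant_le_if_C1_subsolution[OF that g, of c] cell_constant_ge_if_C1_supersolution[OF that g, of c] eq
    by force
  ultimately show ?thesis
    unfolding effective_hamiltonian_def by (intro the_equality) blast+
qed

section \<open>Taylor expansion and moments\<close>

lemma growth_bound:
  fixes f f' :: "real \<Rightarrow> real"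
  assumes D: "\<And>t. \<bar>t - c\<bar> \<le> N \<Longrightarrow> (f has_real_derivative f' t) (at t)"
    and le: "\<And>t. \<bar>t - c\<bar> \<le> N \<Longrightarrow> \<bar>f' t\<bar> \<le> \<bar>f t\<bar>"
    and t: "\<bar>t - c\<bar> \<le> N"
  shows "\<bar>f t\<bar> \<le> exp N * \<bar>f c\<bar>"
proof -
  \<comment> \<open>A Gronwall argument for the square of \<open>f\<close>, which disregards signs
    and zeros of \<open>f\<close>. After weighting by \<open>exp (- 2 * s)\<close> the square
    decreases to the right of \<open>c\<close>; weighted by \<open>exp (2 * s)\<close> it increases
    up to \<open>c\<close>.\<close>
  have prod: "\<bar>f' s * f s\<bar> \<le> (f s)\<^sup>2" if "\<bar>s - c\<bar> \<le> N" for s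
    using mult_right_mono[OF le[OF that], of "\<bar>f s\<bar>"] by (simp add: abs_mult power2_eq_square)
  have "(f t)\<^sup>2 \<le> (exp N * \<bar>f c\<bar>)\<^sup>2"
  proof (cases "c \<le> t")
    case True
    have "(f t)\<^sup>2 * exp (- 2 * t) \<le> (f c)\<^sup>2 * exp (- 2 * c)"
    proof (rule DERIV_nonpos_imp_nonincreasing[OF True])
      fix s assume s: "c \<le> s" "s \<le> t"
      then have sN: "\<bar>s - c\<bar> \<le> N" using t by simp
      have "((\<lambda>s. (f s)\<^sup>2 * exp (- 2 * s)) has_real_derivative
          2 * exp (- 2 * s) * (f' s * f s - (f s)\<^sup>2)) (at s)"
        by (auto intro!: derivative_eq_intros D[OF sN] simp: power2_eq_square algebra_simps)
      moreover have "2 * exp (- 2 * s) * (f' s * f s - (f s)\<^sup>2) \<le> 0"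
        using prod[OF sN] by (intro mult_nonneg_nonpos) auto
      ultimately show "\<exists>y. ((\<lambda>s. (f s)\<^sup>2 * exp (- 2 * s)) has_real_derivative y) (at s) \<and> y \<le> 0" by blast
    qed
    then have "(f t)\<^sup>2 * exp (- 2 * t) * exp (2 * t) \<le> (f c)\<^sup>2 * exp (- 2 * c) * exp (2 * t)"
      by (intro mult_right_mono) auto
    then have "(f t)\<^sup>2 \<le> (f c)\<^sup>2 * exp (2 * (t - c))"
      by (simp add: mult.assoc exp_add[symmetric] algebra_simps)
    also have "\<dots> \<le> (f c)\<^sup>2 * exp (2 * N)" using t by (intro mult_left_mono) auto
    finally show ?thesis by (simp add: power_mult_distrib exp_double mult.commute[of "(f c)\<^sup>2"])
  next
    case False
    have "(f t)\<^sup>2 * exp (2 * t) \<le> (f c)\<^sup>2 * exp (2 * c)"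
    proof (rule DERIV_nonneg_imp_nondecreasing[of t c "\<lambda>s. (f s)\<^sup>2 * exp (2 * s)"])
      fix s assume s: "t \<le> s" "s \<le> c"
      then have sN: "\<bar>s - c\<bar> \<le> N" using t by simp
      have "((\<lambda>s. (f s)\<^sup>2 * exp (2 * s)) has_real_derivative
          2 * exp (2 * s) * (f' s * f s + (f s)\<^sup>2)) (at s)"
        by (auto intro!: derivative_eq_intros D[OF sN] simp: power2_eq_square algebra_simps)
      moreover have "0 \<le> 2 * exp (2 * s) * (f' s * f s + (f s)\<^sup>2)"
        using prod[OF sN] by (intro mult_nonneg_nonneg) auto
      ultimately show "\<exists>y. ((\<lambda>s. (f s)\<^sup>2 * exp (2 * s)) has_real_derivative y) (at s) \<and> 0 \<le> y" by blast
    qed (use False in simp)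
    then have "(f t)\<^sup>2 * exp (2 * t) * exp (- 2 * t) \<le> (f c)\<^sup>2 * exp (2 * c) * exp (- 2 * t)"
      by (intro mult_right_mono) auto
    then have "(f t)\<^sup>2 \<le> (f c)\<^sup>2 * exp (2 * (c - t))"
      by (simp add: mult.assoc exp_add[symmetric] algebra_simps)
    also have "\<dots> \<le> (f c)\<^sup>2 * exp (2 * N)" using t by (intro mult_left_mono) auto
    finally show ?thesis by (simp add: power_mult_distrib exp_double mult.commute[of "(f c)\<^sup>2"])
  qed
  then have "\<bar>f t\<bar> \<le> \<bar>exp N * \<bar>f c\<bar>\<bar>" by (simp only: abs_le_square_iff)
  then show ?thesis by simp
qed

text \<open>Lagrange remainder for the increment \<open>- y\<close>, which explains the alternating
  signs. The factor \<open>1 / fact (Suc k)\<close> is estimated by 1.\<close>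

lemma taylor_bound:
  fixes D :: "nat \<Rightarrow> real \<Rightarrow> real"
  assumes D: "\<And>m t. m \<le> k \<Longrightarrow> \<bar>t - c\<bar> \<le> N \<Longrightarrow> (D m has_real_derivative D (Suc m) t) (at t)"
    and B: "\<And>t. \<bar>t - c\<bar> \<le> N \<Longrightarrow> \<bar>D (Suc k) t\<bar> \<le> B" and N: "0 < N" and y: "\<bar>y\<bar> \<le> N"
  shows "\<bar>D 0 (c - y) - (\<Sum>m\<le>k. D m c / fact m * (- 1) ^ m * y ^ m)\<bar> \<le> B * N ^ Suc k"
proof (cases "y = 0")
  case True
  have "(\<Sum>m\<le>k. D m c / fact m * (- 1) ^ m * y ^ m) = D 0 c"
    using True by (simp add: power_0_left if_distrib sum.delta cong: if_cong)
  moreover have "0 \<le> B" using B[of c] N by linarith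
  ultimately show ?thesis using True N by simp
next
  case False
  have "\<exists>t. (if c - y < c then c - y < t \<and> t < c else c < t \<and> t < c - y) \<and>
      D 0 (c - y) = (\<Sum>m<Suc k. D m c / fact m * ((c - y) - c) ^ m) + D (Suc k) t / fact (Suc k) * ((c - y) - c) ^ Suc k"
    by (rule Taylor[of "Suc k" D "D 0" "c - N" "c + N"]) (use D N y False in \<open>auto simp: abs_le_iff\<close>)
  then obtain t where t: "if c - y < c then c - y < t \<and> t < c else c < t \<and> t < c - y"
    and eq: "D 0 (c - y) = (\<Sum>m<Suc k. D m c / fact m * ((c - y) - c) ^ m) + D (Suc k) t / fact (Suc k) * ((c - y) - c) ^ Suc k"
    by blast
  have tN: "\<bar>t - c\<bar> \<le> N" using t y by (auto split: if_splits)
  have "(\<Sum>m<Suc k. D m c / fact m * ((c - y) - c) ^ m) = (\<Sum>m\<le>k. D m c / fact m * (- 1) ^ m * y ^ m)"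
    by (simp only: lessThan_Suc_atMost) (rule sum.cong, auto simp: power_minus[of y])
  then have "\<bar>D 0 (c - y) - (\<Sum>m\<le>k. D m c / fact m * (- 1) ^ m * y ^ m)\<bar> = \<bar>D (Suc k) t\<bar> / fact (Suc k) * \<bar>y\<bar> ^ Suc k"
    using eq by (simp add: abs_mult power_abs)
  also have "\<dots> \<le> B * N ^ Suc k"
  proof (intro mult_mono power_mono y)
    have "\<bar>D (Suc k) t\<bar> / fact (Suc k) \<le> \<bar>D (Suc k) t\<bar> / 1"
      by (intro divide_left_mono fact_ge_1) (auto simp del: fact_Suc)
    then show "\<bar>D (Suc k) t\<bar> / fact (Suc k) \<le> B" using B[OF tN] by simp
    show "0 \<le> B" using B[OF tN] by linarith
  qed auto
  finally show ?thesis .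
qed

text \<open>Integrating the pointwise expansion turns powers of \<open>V x\<close> into moments of
  \<open>V\<close>.\<close>

lemma taylor_mean_bound:
  fixes D :: "nat \<Rightarrow> real \<Rightarrow> real"
  assumes V: "V \<in> C_torus"
    and D: "\<And>m t. m \<le> k \<Longrightarrow> \<bar>t - c\<bar> \<le> N \<Longrightarrow> (D m has_real_derivative D (Suc m) t) (at t)"
    and B: "\<And>t. \<bar>t - c\<bar> \<le> N \<Longrightarrow> \<bar>D (Suc k) t\<bar> \<le> B" and N: "0 < N" and VN: "\<And>x. \<bar>V x\<bar> \<le> N"
  shows "\<bar>integral {0..1} (\<lambda>x. D 0 (c - V x))
      - (\<Sum>m\<le>k. D m c / fact m * (- 1) ^ m * integral {0..1} (\<lambda>x. V x ^ m))\<bar> \<le> B * N ^ Suc k"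
proof -
  have cV: "continuous_on {0..1} V" using C_torus_continuous[OF V] continuous_on_subset by blast
  have "continuous_on {c-N..c+N} (D 0)"
    by (intro continuous_at_imp_continuous_on ballI DERIV_isCont[OF D[of 0]]) (auto simp: abs_le_iff)
  then have cD: "continuous_on {0..1} (\<lambda>x. D 0 (c - V x))"
    by (rule continuous_on_compose2) (use VN in \<open>auto intro!: continuous_intros cV simp: abs_le_iff\<close>)
  have cS: "continuous_on {0..1} (\<lambda>x. \<Sum>m\<le>k. D m c / fact m * (- 1) ^ m * V x ^ m)"
    by (intro continuous_intros cV)
  have "integral {0..1} (\<lambda>x. D 0 (c - V x) - (\<Sum>m\<le>k. D m c / fact m * (- 1) ^ m * V x ^ m))
     = integral {0..1} (\<lambda>x. D 0 (c - V x)) - integral {0..1} (\<lambda>x. \<Sum>m\<le>k. D m c / fact m * (- 1) ^ m * V x ^ m)"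
    by (intro Henstock_Kurzweil_Integration.integral_diff integrable_continuous_interval cD cS)
  also have "integral {0..1} (\<lambda>x. \<Sum>m\<le>k. D m c / fact m * (- 1) ^ m * V x ^ m)
     = (\<Sum>m\<le>k. D m c / fact m * (- 1) ^ m * integral {0..1} (\<lambda>x. V x ^ m))"
    by (subst Henstock_Kurzweil_Integration.integral_sum)
       (auto intro!: integrable_continuous_interval continuous_intros cV)
  finally have eq: "integral {0..1} (\<lambda>x. D 0 (c - V x) - (\<Sum>m\<le>k. D m c / fact m * (- 1) ^ m * V x ^ m))
     = integral {0..1} (\<lambda>x. D 0 (c - V x)) - (\<Sum>m\<le>k. D m c / fact m * (- 1) ^ m * integral {0..1} (\<lambda>x. V x ^ m))" .
  have "norm (integral {0..1} (\<lambda>x. D 0 (c - V x) - (\<Sum>m\<le>k. D m c / fact m * (- 1) ^ m * V x ^ m))) \<le> B * N ^ Suc k * (1 - 0)"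
  proof (rule integral_bound)
    show "norm (D 0 (c - V x) - (\<Sum>m\<le>k. D m c / fact m * (- 1) ^ m * V x ^ m)) \<le> B * N ^ Suc k" for x
      unfolding real_norm_def by (rule taylor_bound[OF D B N VN])
    show "continuous_on {0..1} (\<lambda>x. D 0 (c - V x) - (\<Sum>m\<le>k. D m c / fact m * (- 1) ^ m * V x ^ m))"
      by (rule continuous_on_diff[OF cD cS])
  qed simp
  then show ?thesis unfolding eq by simp
qed

lemma moments_eq_imp_same_distribution:
  assumes V: "V1 \<in> C_torus" "V2 \<in> C_torus"
    and mom: "\<And>k. integral {0..1} (\<lambda>x. V1 x ^ k) = integral {0..1} (\<lambda>x. V2 x ^ k)"
  shows "same_distribution V1 V2"
  unfolding same_distribution_def
proof (intro allI impI)
  fix f :: "real \<Rightarrow> real" assume f: "continuous_on UNIV f"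
  obtain N1 where N1: "\<And>x. \<bar>V1 x\<bar> \<le> N1" using C_torus_bounded[OF V(1)] by blast
  obtain N2 where N2: "\<And>x. \<bar>V2 x\<bar> \<le> N2" using C_torus_bounded[OF V(2)] by blast
  define N where "N = max N1 N2"
  have cV: "continuous_on {0..1} V1" "continuous_on {0..1} V2"
    using C_torus_continuous[OF V(1)] C_torus_continuous[OF V(2)] continuous_on_subset by blast+
  have "\<bar>integral {0..1} (\<lambda>x. f (V1 x)) - integral {0..1} (\<lambda>x. f (V2 x))\<bar> \<le> 0 + e" if e: "0 < e" for e
  proof -
    have "continuous_on {-N..N} f" using f continuous_on_subset by blast
    then obtain g where g: "real_polynomial_function g" "\<And>x. x \<in> {-N..N} \<Longrightarrow> \<bar>f x - g x\<bar> < e / 2"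
      using Stone_Weierstrass_real_polynomial_function[of "{-N..N}" f "e/2"] e by auto
    obtain a n where an: "g = (\<lambda>x. \<Sum>i\<le>n. a i * x ^ i)"
      using g(1) real_polynomial_function_iff_sum by auto
    have int_g: "integral {0..1} (\<lambda>x. g (V x)) = (\<Sum>i\<le>n. a i * integral {0..1} (\<lambda>x. V x ^ i))"
      if "continuous_on {0..1} V" for V :: "real \<Rightarrow> real"
      unfolding an
      by (subst Henstock_Kurzweil_Integration.integral_sum)
         (auto intro!: integrable_continuous_interval continuous_intros that)
    have est: "\<bar>integral {0..1} (\<lambda>x. f (V x)) - integral {0..1} (\<lambda>x. g (V x))\<bar> \<le> e / 2"
      if cV: "continuous_on {0..1} V" and VN: "\<And>x. \<bar>V x\<bar> \<le> N" for V :: "real \<Rightarrow> real"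
    proof -
      have cf: "continuous_on {0..1} (\<lambda>x. f (V x))" by (rule continuous_on_compose2[OF f cV]) simp
      have cg: "continuous_on {0..1} (\<lambda>x. g (V x))" unfolding an by (intro continuous_intros cV)
      have "norm (integral {0..1} (\<lambda>x. f (V x) - g (V x))) \<le> e / 2 * (1 - 0)"
      proof (rule integral_bound)
        show "norm (f (V t) - g (V t)) \<le> e / 2" for t
          using g(2)[of "V t"] VN[of t] by (simp add: abs_le_iff less_imp_le)
      qed (auto intro: continuous_on_diff cf cg)
      then show ?thesis
        using Henstock_Kurzweil_Integration.integral_diff[OF integrable_continuous_interval[OF cf]
            integrable_continuous_interval[OF cg]] by simp
    qed
    have eq: "integral {0..1} (\<lambda>x. g (V1 x)) = integral {0..1} (\<lambda>x. g (V2 x))"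
      by (simp add: int_g cV mom)
    have "\<bar>V1 x\<bar> \<le> N" "\<bar>V2 x\<bar> \<le> N" for x using N1[of x] N2[of x] by (auto simp: N_def)
    then have "\<bar>integral {0..1} (\<lambda>x. f (V1 x)) - integral {0..1} (\<lambda>x. g (V1 x))\<bar> \<le> e / 2"
      "\<bar>integral {0..1} (\<lambda>x. f (V2 x)) - integral {0..1} (\<lambda>x. g (V2 x))\<bar> \<le> e / 2"
      using est cV by blast+
    then show ?thesis using eq by linarith
  qed
  then have "\<bar>integral {0..1} (\<lambda>x. f (V1 x)) - integral {0..1} (\<lambda>x. f (V2 x))\<bar> \<le> 0"
    by (rule field_le_epsilon)
  then show "integral {0..1} (\<lambda>x. f (V1 x)) = integral {0..1} (\<lambda>x. f (V2 x))" by simp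
qed

section \<open>From the effective Hamiltonian to the moments\<close>

lemma funpow_deriv_eventually:
  assumes "\<forall>\<^sub>F x in at_top. (deriv ^^ k) \<psi> field_differentiable at x"
  shows "\<forall>\<^sub>F x in at_top. ((deriv ^^ k) \<psi> has_real_derivative (deriv ^^ Suc k) \<psi> x) (at (x::real))"
  using assms by (rule eventually_mono) (simp add: DERIV_deriv_iff_field_differentiable)

text \<open>Coercivity makes \<open>H\<close> unbounded on the ray, so by the intermediate value
  theorem every level from \<open>H a\<close> on is attained there.\<close>

lemma
  fixes H :: "real \<Rightarrow> real"
  assumes cont: "continuous_on UNIV H" and coer: "coercive H" and sm: "strict_mono_on {a..} H"
  defines "\<psi> \<equiv> the_inv_into {a..} H"
  shows ray_inverse_right: "H a \<le> s \<Longrightarrow> H (\<psi> s) = s"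
    and ray_inverse_mono: "H a \<le> s \<Longrightarrow> s \<le> t \<Longrightarrow> \<psi> s \<le> \<psi> t"
proof -
  have inj: "inj_on H {a..}" using sm by (rule strict_mono_on_imp_inj_on)
  have surj: "s \<in> H ` {a..}" if as: "H a \<le> s" for s
  proof -
    obtain R where R: "0 < R" "\<And>q. H q \<le> s \<Longrightarrow> \<bar>q\<bar> \<le> R"
      using coercive_sublevel_bounded[OF coer, of s] by metis
    define b where "b = max a (R + 1)"
    have "R < \<bar>b\<bar>" using R(1) by (simp add: b_def)
    then have "s \<le> H b" using R(2)[of b] by linarith
    moreover have "continuous_on {a..b} H" using cont continuous_on_subset by blast
    ultimately obtain x where "a \<le> x" "H x = s"
      using IVT'[of H a s b] as by (auto simp: b_def)
    then show ?thesis by auto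
  qed
  show 1: "H (\<psi> s) = s" if "H a \<le> s" for s
    unfolding \<psi>_def by (rule f_the_inv_into_f[OF inj surj[OF that]])
  have 2: "a \<le> \<psi> s" if "H a \<le> s" for s
    using the_inv_into_into[OF inj surj[OF that] order_refl] by (simp add: \<psi>_def)
  show "\<psi> s \<le> \<psi> t" if st: "H a \<le> s" "s \<le> t" for s t
  proof (rule ccontr)
    assume "\<not> \<psi> s \<le> \<psi> t"
    then have "H (\<psi> t) < H (\<psi> s)"
      using 2 st by (intro strict_mono_onD[OF sm]) auto
    then show False using 1 st by simp
  qed
qed

text \<open>Prepares an intermediate value argument in the level \<open>c\<close>. For
  \<open>c \<ge> X + N\<close> all arguments \<open>c - V x\<close> remain where
  \<open>\<psi>\<close> is continuous.\<close>

lemma mean_of_shift_continuous: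
  fixes \<psi> :: "real \<Rightarrow> real"
  assumes V: "V \<in> C_torus" and VN: "\<And>x. \<bar>V x\<bar> \<le> N" and \<psi>: "continuous_on {X..} \<psi>"
  shows "continuous_on {X + N..} (\<lambda>c. integral {0..1} (\<lambda>x. \<psi> (c - V x)))"
proof -
  have "continuous_on ({X + N..} \<times> {0..1}) (\<lambda>z. V (snd z))"
    by (intro continuous_on_compose2[OF C_torus_continuous[OF V]] continuous_on_snd continuous_on_id) auto
  then have "continuous_on ({X + N..} \<times> {0..1}) (\<lambda>z. fst z - V (snd z))"
    by (intro continuous_on_diff continuous_on_fst continuous_on_id)
  moreover have "X \<le> c - V x" if "X + N \<le> c" for c x
    using VN[of x] that by linarith
  ultimately have "continuous_on ({X + N..} \<times> {0..1}) (\<lambda>z. \<psi> (fst z - V (snd z)))"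
    by (intro continuous_on_compose2[OF \<psi>]) auto
  then show ?thesis
    using integral_continuous_on_param[of "{X + N..}" 0 1 "\<lambda>c x. \<psi> (c - V x)"]
    by (simp add: case_prod_beta)
qed

lemma zero_if_le_all_multiples:
  fixes x K :: real
  assumes "0 \<le> K" "\<And>e. 0 < e \<Longrightarrow> e \<le> 1 \<Longrightarrow> \<bar>x\<bar> \<le> K * e"
  shows "x = 0"
proof (rule ccontr)
  assume x: "x \<noteq> 0"
  define e where "e = min 1 (\<bar>x\<bar> / (2 * (K + 1)))"
  have e: "0 < e" "e \<le> 1" using x assms(1) by (auto simp: e_def)
  have "e \<le> \<bar>x\<bar> / (2 * (K + 1))" by (simp add: e_def)
  then have "2 * ((K + 1) * e) \<le> \<bar>x\<bar>" using assms(1) by (simp add: field_simps)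
  moreover have "K * e < (K + 1) * e" using e by simp
  moreover have "0 \<le> K * e" using assms(1) e by simp
  ultimately show False using assms(2)[OF e] x by linarith
qed

text \<open>Once the lower moments agree, the two Taylor sums of order \<open>k\<close> at a large
  \<open>c\<close> differ by the \<open>k\<close>-th term only. The remainders are at most a
  constant times \<open>e * \<bar>D k c\<bar>\<close>. Division by \<open>D k c\<close> and
  arbitrariness of \<open>e\<close> make the \<open>k\<close>-th moments equal.\<close>

lemma moments_eq_if_means_eq:
  fixes D :: "nat \<Rightarrow> real \<Rightarrow> real"
  assumes V: "V1 \<in> C_torus" "V2 \<in> C_torus"
    and D: "\<And>k. \<forall>\<^sub>F x in at_top. (D k has_real_derivative D (Suc k) x) (at x)"
    and nz: "\<And>k. \<forall>\<^sub>F x in at_top. D k x \<noteq> 0"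
    and lim: "\<And>k. ((\<lambda>x. D (Suc k) x / D k x) \<longlongrightarrow> 0) at_top"
    and mean: "\<forall>\<^sub>F c in at_top. integral {0..1} (\<lambda>x. D 0 (c - V1 x)) = integral {0..1} (\<lambda>x. D 0 (c - V2 x))"
  shows "integral {0..1} (\<lambda>x. V1 x ^ k) = integral {0..1} (\<lambda>x. V2 x ^ k)"
proof (induction k rule: less_induct)
  case (less k)
  define \<Delta> where "\<Delta> = (\<lambda>m. integral {0..1} (\<lambda>x. V1 x ^ m) - integral {0..1} (\<lambda>x. V2 x ^ m))"
  obtain N1 where N1: "0 < N1" "\<And>x. \<bar>V1 x\<bar> \<le> N1" using C_torus_bounded[OF V(1)] by blast
  obtain N2 where N2: "0 < N2" "\<And>x. \<bar>V2 x\<bar> \<le> N2" using C_torus_bounded[OF V(2)] by blast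
  define N where "N = max N1 N2"
  have N: "0 < N" "\<And>x. \<bar>V1 x\<bar> \<le> N" "\<And>x. \<bar>V2 x\<bar> \<le> N"
    using N1 N2 by (auto simp: N_def le_max_iff_disj)
  have "\<bar>\<Delta> k\<bar> \<le> 2 * fact k * exp N * N ^ Suc k * e" if e: "0 < e" "e \<le> 1" for e
  proof -
    have "\<forall>\<^sub>F x in at_top. \<bar>D (Suc k) x / D k x\<bar> < e"
      using tendstoD[OF lim[of k] e(1)] by (simp add: dist_real_def)
    moreover have "\<forall>\<^sub>F x in at_top. \<forall>m\<in>{..k}. (D m has_real_derivative D (Suc m) x) (at x)"
      by (intro eventually_ball_finite) (auto intro: D)
    ultimately have "\<forall>\<^sub>F x in at_top. \<bar>D (Suc k) x / D k x\<bar> < e \<and> D k x \<noteq> 0 \<and>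
        (\<forall>m\<in>{..k}. (D m has_real_derivative D (Suc m) x) (at x)) \<and>
        integral {0..1} (\<lambda>y. D 0 (x - V1 y)) = integral {0..1} (\<lambda>y. D 0 (x - V2 y))"
      using nz[of k] mean by eventually_elim blast
    then obtain X where X: "\<And>x. X \<le> x \<Longrightarrow> \<bar>D (Suc k) x / D k x\<bar> < e" "\<And>x. X \<le> x \<Longrightarrow> D k x \<noteq> 0"
      "\<And>x m. X \<le> x \<Longrightarrow> m \<le> k \<Longrightarrow> (D m has_real_derivative D (Suc m) x) (at x)"
      "\<And>x. X \<le> x \<Longrightarrow> integral {0..1} (\<lambda>y. D 0 (x - V1 y)) = integral {0..1} (\<lambda>y. D 0 (x - V2 y))"
      unfolding eventually_at_top_linorder by auto
    \<comment> \<open>With this centre the whole window of radius \<open>N\<close> lies beyond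
      \<open>X\<close>.\<close>
    define c where "c = X + N"
    have ge: "X \<le> t" if "\<bar>t - c\<bar> \<le> N" for t using that by (simp add: c_def abs_le_iff)
    have quot: "\<bar>D (Suc k) t\<bar> \<le> e * \<bar>D k t\<bar>" if "\<bar>t - c\<bar> \<le> N" for t
      using X(1,2)[OF ge[OF that]] by (simp add: abs_divide divide_less_eq less_imp_le)
    have "\<bar>D (Suc k) t\<bar> \<le> \<bar>D k t\<bar>" if "\<bar>t - c\<bar> \<le> N" for t
      using quot[OF that] mult_right_mono[OF e(2), of "\<bar>D k t\<bar>"] by simp
    \<comment> \<open>The remainder involves \<open>D (Suc k)\<close> at an intermediate point.
      Passing to \<open>D k\<close> there and then to \<open>D k c\<close> makes it comparable with
      the \<open>k\<close>-th term, whose coefficient is taken at \<open>c\<close>.\<close>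
    then have growth: "\<bar>D k t\<bar> \<le> exp N * \<bar>D k c\<bar>" if "\<bar>t - c\<bar> \<le> N" for t
      using growth_bound[of c N "D k" "D (Suc k)", OF X(3)[OF ge order_refl] _ that] by blast
    define B where "B = e * (exp N * \<bar>D k c\<bar>)"
    have B: "\<bar>D (Suc k) t\<bar> \<le> B" if "\<bar>t - c\<bar> \<le> N" for t
      using quot[OF that] mult_left_mono[OF growth[OF that], of e] e(1) unfolding B_def by linarith
    define S where "S = (\<lambda>V :: real \<Rightarrow> real. \<Sum>m\<le>k. D m c / fact m * (- 1) ^ m * integral {0..1} (\<lambda>x. V x ^ m))"
    have T: "\<bar>integral {0..1} (\<lambda>x. D 0 (c - V1 x)) - S V1\<bar> \<le> B * N ^ Suc k"
      "\<bar>integral {0..1} (\<lambda>x. D 0 (c - V2 x)) - S V2\<bar> \<le> B * N ^ Suc k"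
      unfolding S_def
      by (rule taylor_mean_bound; use V X(3) ge B N in blast)+
    have "S V1 - S V2 = (\<Sum>m\<le>k. D m c / fact m * (- 1) ^ m * \<Delta> m)"
      by (simp add: S_def \<Delta>_def sum_subtractf[symmetric] right_diff_distrib)
    also have "\<dots> = D k c / fact k * (- 1) ^ k * \<Delta> k"
    proof -
      have "(\<Sum>m<k. D m c / fact m * (- 1) ^ m * \<Delta> m) = 0"
        by (rule sum.neutral) (use less.IH in \<open>auto simp: \<Delta>_def\<close>)
      then show ?thesis by (simp add: lessThan_Suc_atMost[symmetric])
    qed
    finally have "\<bar>S V1 - S V2\<bar> = \<bar>D k c\<bar> / fact k * \<bar>\<Delta> k\<bar>"
      by (simp add: abs_mult)
    moreover have "\<bar>S V1 - S V2\<bar> \<le> 2 * (B * N ^ Suc k)"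
      using T X(4)[of c] N(1) by (simp add: c_def)
    ultimately have "\<bar>D k c\<bar> / fact k * \<bar>\<Delta> k\<bar> \<le> 2 * (B * N ^ Suc k)" by simp
    then have "\<bar>D k c\<bar> * \<bar>\<Delta> k\<bar> \<le> \<bar>D k c\<bar> * (2 * fact k * exp N * N ^ Suc k * e)"
      by (simp add: B_def field_simps)
    moreover have "0 < \<bar>D k c\<bar>" using X(2)[of c] N(1) by (simp add: c_def)
    ultimately show ?thesis by (simp only: mult_le_cancel_left_pos)
  qed
  then have "\<Delta> k = 0"
    by (rule zero_if_le_all_multiples[rotated]) (use N(1) in auto)
  then show ?case by (simp add: \<Delta>_def)
qed

lemma same_distribution_if_effective_hamiltonian_eq:
  assumes cont: "continuous_on UNIV H" and coer: "coercive H"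
    and V: "V1 \<in> C_torus" "V2 \<in> C_torus"
    and ssl: "strongly_superlinear H"
    and eff: "effective_hamiltonian H V1 = effective_hamiltonian H V2"
  shows "same_distribution V1 V2"
proof -
  obtain a where sm: "strict_mono_on {a..} H"
    and D: "\<And>k. \<forall>\<^sub>F x in at_top. (deriv ^^ k) (the_inv_into {a..} H) field_differentiable at x"
    and nz: "\<And>k. \<forall>\<^sub>F x in at_top. (deriv ^^ k) (the_inv_into {a..} H) x \<noteq> 0"
    and lim: "\<And>k. ((\<lambda>x. (deriv ^^ Suc k) (the_inv_into {a..} H) x / (deriv ^^ k) (the_inv_into {a..} H) x) \<longlongrightarrow> 0) at_top"
    using ssl unfolding strongly_superlinear_def Let_def by blast
  define \<psi> where "\<psi> = the_inv_into {a..} H"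
  note inverse = ray_inverse_right[OF cont coer sm, folded \<psi>_def] ray_inverse_mono[OF cont coer sm, folded \<psi>_def]
  obtain X' where X': "\<And>x. X' \<le> x \<Longrightarrow> \<psi> field_differentiable at x"
    using D[of 0] unfolding eventually_at_top_linorder \<psi>_def by auto
  define X where "X = max X' (H a)"
  have c\<psi>: "continuous_on {X..} \<psi>"
    by (intro continuous_at_imp_continuous_on ballI field_differentiable_imp_continuous_at X')
       (auto simp: X_def)
  obtain N1 where N1: "0 < N1" "\<And>x. \<bar>V1 x\<bar> \<le> N1" using C_torus_bounded[OF V(1)] by blast
  obtain N2 where N2: "0 < N2" "\<And>x. \<bar>V2 x\<bar> \<le> N2" using C_torus_bounded[OF V(2)] by blast
  define N where "N = max N1 N2"
  have N: "0 < N" "\<And>x. \<bar>V1 x\<bar> \<le> N" "\<And>x. \<bar>V2 x\<bar> \<le> N"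
    using N1 N2 by (auto simp: N_def le_max_iff_disj)
  define I where "I = (\<lambda>(V :: real \<Rightarrow> real) c. integral {0..1} (\<lambda>x. \<psi> (c - V x)))"
  have slope: "continuous_on UNIV (\<lambda>x. \<psi> (c - V x))"
    if "V \<in> C_torus" "\<And>x. \<bar>V x\<bar> \<le> N" "X + N \<le> c" for V c
  proof (rule continuous_on_compose2[OF c\<psi>])
    show "continuous_on UNIV (\<lambda>x. c - V x)"
      by (intro continuous_intros C_torus_continuous that(1))
    have "X \<le> c - V x" for x using that(2)[of x] that(3) by linarith
    then show "(\<lambda>x. c - V x) ` UNIV \<subseteq> {X..}" by auto
  qed
  have effI: "effective_hamiltonian H V (I V c) = c"
    if VT: "V \<in> C_torus" and VN: "\<And>x. \<bar>V x\<bar> \<le> N" and c: "X + N \<le> c" for V c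
  proof (rule effective_hamiltonian_eq_if_C1_solution[OF slope[OF that]])
    show "integral {0..1} (\<lambda>x. \<psi> (c - V x)) = I V c" by (simp add: I_def)
    show "\<psi> (c - V (x + 1)) = \<psi> (c - V x)" for x by (simp add: C_torus_periodic[OF VT])
    have "H a \<le> c - V x" for x
    proof -
      have "H a \<le> X" by (simp add: X_def)
      then show ?thesis using VN[of x] c by linarith
    qed
    then show "H (\<psi> (c - V x)) + V x = c" for x using inverse(1) by simp
  qed
  \<comment> \<open>Both potentials are bounded by \<open>N\<close>, so a shift of the level by
    \<open>2 * N\<close> outweighs their difference at every point.\<close>
  have I_le: "I V c \<le> I W c'"
    if "V \<in> C_torus" "W \<in> C_torus" "\<And>x. \<bar>V x\<bar> \<le> N" "\<And>x. \<bar>W x\<bar> \<le> N" "X + N \<le> c" "c + 2 * N \<le> c'" for V W c c'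
    unfolding I_def
  proof (rule integral_le)
    show "(\<lambda>x. \<psi> (c - V x)) integrable_on {0..1}" "(\<lambda>x. \<psi> (c' - W x)) integrable_on {0..1}"
      using slope that N(1) by (auto intro!: continuous_integrable)
    show "\<psi> (c - V x) \<le> \<psi> (c' - W x)" for x
      using that(3)[of x] that(4)[of x] that(5,6) by (intro inverse(2)) (auto simp: X_def abs_le_iff)
  qed
  \<comment> \<open>The mean \<open>I V1 c\<close> is also the mean of \<open>V2\<close> at some
    level \<open>c2\<close>. At this common mean the effective Hamiltonians are \<open>c\<close> and
    \<open>c2\<close>, so \<open>c2 = c\<close>. The margin \<open>3 * N\<close> keeps
    \<open>c - 2 * N\<close> in the range of \<open>effI\<close>.\<close>
  have "I V1 c = I V2 c" if c: "X + 3 * N \<le> c" for c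
  proof -
    have "continuous_on {X + N..} (I V2)"
      unfolding I_def by (rule mean_of_shift_continuous[OF V(2) N(3) c\<psi>])
    then have "continuous_on {c - 2 * N..c + 2 * N} (I V2)"
      by (rule continuous_on_subset) (use c in auto)
    moreover have "I V2 (c - 2 * N) \<le> I V1 c" "I V1 c \<le> I V2 (c + 2 * N)"
      using I_le[OF V(2,1) N(3,2)] I_le[OF V N(2,3)] c N(1) by auto
    ultimately obtain c2 where c2: "c - 2 * N \<le> c2" "I V2 c2 = I V1 c"
      using IVT'[of "I V2" "c - 2 * N" "I V1 c" "c + 2 * N"] N(1) by auto
    have "c2 = effective_hamiltonian H V2 (I V2 c2)"
      using effI[OF V(2) N(3), of c2] c2 c by simp
    also have "\<dots> = effective_hamiltonian H V1 (I V1 c)" using eff c2 by simp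
    also have "\<dots> = c" using effI[OF V(1) N(2), of c] c N(1) by simp
    finally show ?thesis using c2(2) by simp
  qed
  then have mean: "\<forall>\<^sub>F c in at_top. integral {0..1} (\<lambda>x. \<psi> (c - V1 x)) = integral {0..1} (\<lambda>x. \<psi> (c - V2 x))"
    unfolding I_def by (rule eventually_at_top_linorderI)
  show ?thesis
  proof (rule moments_eq_imp_same_distribution[OF V])
    show "integral {0..1} (\<lambda>x. V1 x ^ k) = integral {0..1} (\<lambda>x. V2 x ^ k)" for k
      by (rule moments_eq_if_means_eq[of V1 V2 "\<lambda>k. (deriv ^^ k) \<psi>"])
         (use V funpow_deriv_eventually[OF D] nz lim mean in \<open>simp_all add: \<psi>_def\<close>)
  qed
qed

theorem theorem1p3:
  fixes H V1 V2 :: "real \<Rightarrow> real"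
  assumes "continuous_on UNIV H"
    and "coercive H"
    and "V1 \<in> C_torus"
    and "V2 \<in> C_torus"
  shows "(quasi_convex H \<longrightarrow>
            (same_distribution V1 V2 \<longrightarrow>
               effective_hamiltonian H V1 = effective_hamiltonian H V2)) \<and>
         (strongly_superlinear H \<longrightarrow>
            (effective_hamiltonian H V1 = effective_hamiltonian H V2 \<longrightarrow>
               same_distribution V1 V2))"
proof (intro conjI impI)
  assume qc: "quasi_convex H" and dist: "same_distribution V1 V2"
  obtain q0 where "\<And>q. H q0 \<le> H q" using coercive_attains_min[OF assms(1,2)] by blast
  then interpret qc_hamiltonian H q0 using assms(1,2) qc by unfold_locales
  show "effective_hamiltonian H V1 = effective_hamiltonian H V2"
    by (rule effective_hamiltonian_cong_distribution[OF assms(3,4) dist])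
qed (rule same_distribution_if_effective_hamiltonian_eq[OF assms])

end
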